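(* Let $\mathfrak M$ be a finite De Morgan algebra and $\alpha$ an ordinal. If $\mathfrak B$ is a cylindric algebra of dimension $\alpha$ ($\mathrm{CA}_\alpha$), then $\mathfrak M(\mathfrak B)$ is an $\mathfrak M$-cylindric algebra of dimension $\alpha$ ($\mathfrak M\text{-}\mathrm{CA}_\alpha$).
   Context: **De Morgan algebra.** $\mathfrak M=\langle M,+,\cdot,-,0,1\rangle$ is a finite De Morgan algebra with $0\neq 1$: $+$ and $\cdot$ are commutative, associative, each distributes over the other, $x+0=x$, $x\cdot 1=x$, $x\cdot(x+y)=x=x+(x\cdot y)$, $-(x+y)=-x\cdot -y$, $-(x\cdot y)=-x+-y$, $--x=x$. $M$ is ordered by $x\le y$ iff $x\cdot y=x$ (equivalently $x+y=y$). Whenever $\sup A$ is written, $A$ ranges over nonempty subsets of $M$, and $\sup A$ is the $+$-sum of the elements of $A$. **Cylindric algebra.** A $\mathrm{CA}_\alpha$ is $\mathfrak B=\langle B,+,\cdot,-,0,1,c_\kappa,d_{\kappa\lambda}\rangle_{\kappa,\lambda<\alpha}$ whose reduct to $+,\cdot,-,0,1$ is a Boolean algebra and such that for all $x,y\in B$, $\kappa,\lambda,\mu<\alpha$: $c_\kappa 0=0$; $x\le c_\kappa x$; $c_\kappa(x\cdot c_\kappa y)=c_\kappa x\cdot c_\kappa y$; $c_\kappa c_\lambda x=c_\lambda c_\kappa x$; $d_{\kappa\kappa}=1$; $d_{\lambda\mu}=c_\kappa(d_{\lambda\kappa}\cdot d_{\kappa\mu})$ if $\kappa\notin\{\lambda,\mu\}$;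 $c_\kappa(d_{\kappa\lambda}\cdot x)\cdot c_\kappa(d_{\kappa\lambda}\cdot -x)=0$ if $\kappa\ne\lambda$. **The algebra $\mathfrak M(\mathfrak B)$.** For a $\mathrm{CA}_\alpha$ $\mathfrak B$, its universe is the set $F$ of functions $x:M\to B$ (write $x^p=x(p)$) with $x^p\cdot x^q=0$ for $p\ne q$ and $\sum_{p\in M}x^p=1$. The operations are, for $p,q\in M$ and $\kappa,\lambda<\alpha$: $(x+y)^p=\sum_{q+r=p}x^q\cdot y^r$; $(x\cdot y)^p=\sum_{q\cdot r=p}x^q\cdot y^r$; $(-x)^p=x^{-p}$; $(u_q)^p=1$ if $p=q$ and $0$ otherwise; $$(c_\kappa x)^p=\Big(\sum_{\sup A=p}\ \prod_{q\in A}c_\kappa x^q\Big)\cdot -\Big(\sum_{\sup A>p}\ \prod_{q\in A}c_\kappa x^q\Big);$$ $(d_{\kappa\lambda})^p=d_{\kappa\lambda}$ if $p=1$, $-d_{\kappa\lambda}$ if $p=0$, $0$ if $p\ne 0,1$; $(\delta_q x)^p=x^q$ if $p=1$, $-x^q$ if $p=0$, $0$ if $p\neq 0,1$. (On the right-hand sides operations are those of $\mathfrak B$; indices $q+r$, $q\cdot r$, $-p$ are computed in $\mathfrak M$.) **$\mathfrak M$-cylindric algebra.** An $\mathfrak M\text{-}\mathrm{CA}_\alpha$ is $\mathfrak A=\langle A,+,\cdot,-,u_p,c_\kappa,d_{\kappa\lambda},\delta_p\rangle_{\kappa,\lambda<\alpha,\,p\in M}$ with $+,\cdot$ binary, $-,c_\kappa,\delta_p$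 unary, $u_p,d_{\kappa\lambda}\in A$, satisfying for all $a,b,c\in A$, $p,q\in M$, $\kappa,\lambda,\mu<\alpha$ (finite $\sum,\prod$ are iterated $+,\cdot$; an empty sum is $u_0$): (1)–(3) $+$ and $\cdot$ are commutative, associative and each distributes over the other; (4) $a+u_0=a$, $a\cdot u_1=a$; (5) $\delta_pa+-\delta_pa=u_1$, $\delta_pa\cdot-\delta_pa=u_0$; (6) $c_\kappa u_0=u_0$; (7) $a+c_\kappa a=c_\kappa a$; (8) $c_\kappa(a\cdot c_\kappa b)=c_\kappa a\cdot c_\kappa b$; (9) $c_\kappa c_\lambda a=c_\lambda c_\kappa a$; (10) $d_{\lambda\mu}=c_\kappa(d_{\lambda\kappa}\cdot d_{\kappa\mu})$ if $\kappa\notin\{\lambda,\mu\}$; (11) $d_{\kappa\kappa}=u_1$; (12) $c_\kappa(d_{\kappa\lambda}\cdot\delta_1a)\cdot c_\kappa(d_{\kappa\lambda}\cdot-\delta_1a)=u_0$ if $\kappa\ne\lambda$; (13) $\delta_1(\delta_1a+\delta_1b)=\delta_1a+\delta_1b$; (14) $\delta_1(\delta_1a\cdot\delta_1b)=\delta_1a\cdot\delta_1b$; (15) $\delta_1-\delta_1a=-\delta_1a$; (16) $\delta_1c_\kappa\delta_1a=c_\kappa\delta_1a$; (17) $\delta_1d_{\kappa\lambda}=d_{\kappa\lambda}$; (18) $\delta_0d_{\kappa\lambda}=-d_{\kappa\lambda}$; (19) $\delta_pd_{\kappa\lambda}=u_0$ if $p\ne0,1$; (20) $\delta_p(-a)=\delta_{-p}a$;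 (21) $\delta_pu_p=u_1$; (22) $\delta_pu_q=u_0$ if $p\neq q$; (23) $\delta_pa\cdot\delta_qa=u_0$ if $p\ne q$; (24) $\sum_{p\in M}\delta_pa=u_1$; (25) $\delta_p(a+b)=\sum_{q+r=p}\delta_qa\cdot\delta_rb$; (26) $\delta_p(a\cdot b)=\sum_{q\cdot r=p}\delta_qa\cdot\delta_rb$; (27) $\delta_1\delta_qa=\delta_qa$; (28) $\delta_p\delta_qa=u_0$ if $p\neq0,1$; (29) $\delta_0\delta_qa=-\delta_qa$; (30) if $\delta_pa=\delta_pb$ for all $p\in M$, then $a=b$; (31) $\delta_pc_\kappa a=\big(\sum_{\sup A=p}\prod_{q\in A}c_\kappa\delta_qa\big)\cdot-\big(\sum_{\sup A>p}\prod_{q\in A}c_\kappa\delta_qa\big)$. *)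

theory Defs
  imports "HOL-Algebra.Ring" "HOL-Library.FuncSet"
begin

text \<open>
  All signatures extend the record \<open>ring\<close>, whose \<open>\<oplus>\<close>, \<open>\<otimes>\<close>, \<open>\<zero>\<close>, \<open>\<one>\<close> are the lattice operations
  \<open>+\<close>, \<open>\<cdot>\<close>, \<open>0\<close>, \<open>1\<close>; no ring axioms are assumed. Finite sums and products are \<open>finsum\<close> and \<open>finprod\<close>.
  An ordinal \<open>\<alpha>\<close> is given by a well-order relation, and \<open>\<kappa> < \<alpha>\<close> is rendered as \<open>\<kappa> \<in> Field \<alpha>\<close>;
  the ordinal 0 is the empty relation.
\<close>

record 'a lattice_alg = "'a ring" +
  neg :: "'a \<Rightarrow> 'a" (\<open>\<sim>\<index> _\<close> [81] 80)

record ('a, 'k) cyl_alg = "'a lattice_alg" +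
  cyl :: "'k \<Rightarrow> 'a \<Rightarrow> 'a"
  diag :: "'k \<Rightarrow> 'k \<Rightarrow> 'a"

record ('a, 'k, 'm) mcyl_alg = "('a, 'k) cyl_alg" +
  unit :: "'m \<Rightarrow> 'a"
  delta :: "'m \<Rightarrow> 'a \<Rightarrow> 'a"


text \<open>
  The two monoid locales contribute closure, commutativity and associativity of \<open>\<oplus>\<close> and \<open>\<otimes>\<close>
  and the neutrality of \<open>\<zero>\<close> and \<open>\<one>\<close>.
\<close>

locale bounded_distrib_lattice = abelian_monoid L + comm_monoid L for L (structure) +
  assumes mult_add_distrib:
      "\<lbrakk>x \<in> carrier L; y \<in> carrier L; z \<in> carrier L\<rbrakk> \<Longrightarrow> x \<otimes> (y \<oplus> z) = (x \<otimes> y) \<oplus> (x \<otimes> z)"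
    and add_mult_distrib:
      "\<lbrakk>x \<in> carrier L; y \<in> carrier L; z \<in> carrier L\<rbrakk> \<Longrightarrow> x \<oplus> (y \<otimes> z) = (x \<oplus> y) \<otimes> (x \<oplus> z)"
    and mult_absorb: "\<lbrakk>x \<in> carrier L; y \<in> carrier L\<rbrakk> \<Longrightarrow> x \<otimes> (x \<oplus> y) = x"
    and add_absorb: "\<lbrakk>x \<in> carrier L; y \<in> carrier L\<rbrakk> \<Longrightarrow> x \<oplus> (x \<otimes> y) = x"

locale finite_de_morgan_algebra = bounded_distrib_lattice M for M (structure) +
  assumes neg_closed: "x \<in> carrier M \<Longrightarrow> \<sim> x \<in> carrier M"
    and neg_add: "\<lbrakk>x \<in> carrier M; y \<in> carrier M\<rbrakk> \<Longrightarrow> \<sim> (x \<oplus> y) = \<sim> x \<otimes> \<sim> y"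
    and neg_mult: "\<lbrakk>x \<in> carrier M; y \<in> carrier M\<rbrakk> \<Longrightarrow> \<sim> (x \<otimes> y) = \<sim> x \<oplus> \<sim> y"
    and neg_neg: "x \<in> carrier M \<Longrightarrow> \<sim> (\<sim> x) = x"
    and finite_carrier: "finite (carrier M)"
    and zero_neq_one: "\<zero> \<noteq> \<one>"

locale boolean_alg = bounded_distrib_lattice B for B (structure) +
  assumes compl_closed: "x \<in> carrier B \<Longrightarrow> \<sim> x \<in> carrier B"
    and mult_compl: "x \<in> carrier B \<Longrightarrow> x \<otimes> \<sim> x = \<zero>"
    and add_compl: "x \<in> carrier B \<Longrightarrow> x \<oplus> \<sim> x = \<one>"

definition lle :: "('a, 'z) lattice_alg_scheme \<Rightarrow> 'a \<Rightarrow> 'a \<Rightarrow> bool" where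
  "lle L x y \<longleftrightarrow> x \<otimes>\<^bsub>L\<^esub> y = x"

definition lsup :: "('a, 'z) lattice_alg_scheme \<Rightarrow> 'a set \<Rightarrow> 'a" where
  "lsup L S = finsum L (\<lambda>q. q) S"

definition sets_sup_eq :: "('a, 'z) lattice_alg_scheme \<Rightarrow> 'a \<Rightarrow> 'a set set" where
  "sets_sup_eq M p = {S. S \<subseteq> carrier M \<and> S \<noteq> {} \<and> lsup M S = p}"

definition sets_sup_gt :: "('a, 'z) lattice_alg_scheme \<Rightarrow> 'a \<Rightarrow> 'a set set" where
  "sets_sup_gt M p = {S. S \<subseteq> carrier M \<and> S \<noteq> {} \<and> lle M p (lsup M S) \<and> p \<noteq> lsup M S}"

definition add_pairs :: "('a, 'z) lattice_alg_scheme \<Rightarrow> 'a \<Rightarrow> ('a \<times> 'a) set" where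
  "add_pairs M p = {(q, r). q \<in> carrier M \<and> r \<in> carrier M \<and> q \<oplus>\<^bsub>M\<^esub> r = p}"

definition mult_pairs :: "('a, 'z) lattice_alg_scheme \<Rightarrow> 'a \<Rightarrow> ('a \<times> 'a) set" where
  "mult_pairs M p = {(q, r). q \<in> carrier M \<and> r \<in> carrier M \<and> q \<otimes>\<^bsub>M\<^esub> r = p}"


locale cylindric_algebra = boolean_alg B for B (structure) and \<alpha> :: "'k rel" +
  assumes cyl_closed: "\<lbrakk>\<kappa> \<in> Field \<alpha>; x \<in> carrier B\<rbrakk> \<Longrightarrow> cyl B \<kappa> x \<in> carrier B"
    and diag_closed: "\<lbrakk>\<kappa> \<in> Field \<alpha>; \<nu> \<in> Field \<alpha>\<rbrakk> \<Longrightarrow> diag B \<kappa> \<nu> \<in> carrier B"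
    and cyl_zero: "\<kappa> \<in> Field \<alpha> \<Longrightarrow> cyl B \<kappa> \<zero> = \<zero>"
    and cyl_ge: "\<lbrakk>\<kappa> \<in> Field \<alpha>; x \<in> carrier B\<rbrakk> \<Longrightarrow> lle B x (cyl B \<kappa> x)"
    and cyl_mult_cyl: "\<lbrakk>\<kappa> \<in> Field \<alpha>; x \<in> carrier B; y \<in> carrier B\<rbrakk>
      \<Longrightarrow> cyl B \<kappa> (x \<otimes> cyl B \<kappa> y) = cyl B \<kappa> x \<otimes> cyl B \<kappa> y"
    and cyl_commute: "\<lbrakk>\<kappa> \<in> Field \<alpha>; \<nu> \<in> Field \<alpha>; x \<in> carrier B\<rbrakk>
      \<Longrightarrow> cyl B \<kappa> (cyl B \<nu> x) = cyl B \<nu> (cyl B \<kappa> x)"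
    and diag_refl: "\<kappa> \<in> Field \<alpha> \<Longrightarrow> diag B \<kappa> \<kappa> = \<one>"
    and diag_trans: "\<lbrakk>\<kappa> \<in> Field \<alpha>; \<nu> \<in> Field \<alpha>; \<mu> \<in> Field \<alpha>; \<kappa> \<notin> {\<nu>, \<mu>}\<rbrakk>
      \<Longrightarrow> diag B \<nu> \<mu> = cyl B \<kappa> (diag B \<nu> \<kappa> \<otimes> diag B \<kappa> \<mu>)"
    and cyl_diag: "\<lbrakk>\<kappa> \<in> Field \<alpha>; \<nu> \<in> Field \<alpha>; \<kappa> \<noteq> \<nu>; x \<in> carrier B\<rbrakk>
      \<Longrightarrow> cyl B \<kappa> (diag B \<kappa> \<nu> \<otimes> x) \<otimes> cyl B \<kappa> (diag B \<kappa> \<nu> \<otimes> \<sim> x) = \<zero>"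


text \<open>
  The signature of an \<open>M\<close>-cylindric algebra has no constants 0 and 1 of its own: the record fields
  \<open>\<zero>\<close> and \<open>\<one>\<close>, needed for \<open>finsum\<close> and \<open>finprod\<close>, are required to be \<open>u_0\<close> and \<open>u_1\<close>, so that the
  neutral-element laws of the two monoid locales are those for \<open>u_0\<close> and \<open>u_1\<close>.
\<close>

locale m_cylindric_algebra =
  abelian_monoid A + comm_monoid A + M: finite_de_morgan_algebra M
  for A (structure) and M and \<alpha> :: "'k rel" +
  assumes zero_eq_unit: "\<zero> = unit A \<zero>\<^bsub>M\<^esub>"
    and one_eq_unit: "\<one> = unit A \<one>\<^bsub>M\<^esub>"
    and neg_closed: "a \<in> carrier A \<Longrightarrow> \<sim> a \<in> carrier A"
    and unit_closed: "p \<in> carrier M \<Longrightarrow> unit A p \<in> carrier A"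
    and cyl_closed: "\<lbrakk>\<kappa> \<in> Field \<alpha>; a \<in> carrier A\<rbrakk> \<Longrightarrow> cyl A \<kappa> a \<in> carrier A"
    and diag_closed: "\<lbrakk>\<kappa> \<in> Field \<alpha>; \<nu> \<in> Field \<alpha>\<rbrakk> \<Longrightarrow> diag A \<kappa> \<nu> \<in> carrier A"
    and delta_closed: "\<lbrakk>p \<in> carrier M; a \<in> carrier A\<rbrakk> \<Longrightarrow> delta A p a \<in> carrier A"
    and mult_add_distrib: "\<lbrakk>a \<in> carrier A; b \<in> carrier A; c \<in> carrier A\<rbrakk>
      \<Longrightarrow> a \<otimes> (b \<oplus> c) = (a \<otimes> b) \<oplus> (a \<otimes> c)"
    and add_mult_distrib: "\<lbrakk>a \<in> carrier A; b \<in> carrier A; c \<in> carrier A\<rbrakk>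
      \<Longrightarrow> a \<oplus> (b \<otimes> c) = (a \<oplus> b) \<otimes> (a \<oplus> c)"
    and delta_add_neg: "\<lbrakk>p \<in> carrier M; a \<in> carrier A\<rbrakk>
      \<Longrightarrow> delta A p a \<oplus> \<sim> (delta A p a) = unit A \<one>\<^bsub>M\<^esub>"
    and delta_mult_neg: "\<lbrakk>p \<in> carrier M; a \<in> carrier A\<rbrakk>
      \<Longrightarrow> delta A p a \<otimes> \<sim> (delta A p a) = unit A \<zero>\<^bsub>M\<^esub>"
    and cyl_unit_zero: "\<kappa> \<in> Field \<alpha> \<Longrightarrow> cyl A \<kappa> (unit A \<zero>\<^bsub>M\<^esub>) = unit A \<zero>\<^bsub>M\<^esub>"
    and add_cyl: "\<lbrakk>\<kappa> \<in> Field \<alpha>; a \<in> carrier A\<rbrakk> \<Longrightarrow> a \<oplus> cyl A \<kappa> a = cyl A \<kappa> a"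
    and cyl_mult_cyl: "\<lbrakk>\<kappa> \<in> Field \<alpha>; a \<in> carrier A; b \<in> carrier A\<rbrakk>
      \<Longrightarrow> cyl A \<kappa> (a \<otimes> cyl A \<kappa> b) = cyl A \<kappa> a \<otimes> cyl A \<kappa> b"
    and cyl_commute: "\<lbrakk>\<kappa> \<in> Field \<alpha>; \<nu> \<in> Field \<alpha>; a \<in> carrier A\<rbrakk>
      \<Longrightarrow> cyl A \<kappa> (cyl A \<nu> a) = cyl A \<nu> (cyl A \<kappa> a)"
    and diag_trans: "\<lbrakk>\<kappa> \<in> Field \<alpha>; \<nu> \<in> Field \<alpha>; \<mu> \<in> Field \<alpha>; \<kappa> \<notin> {\<nu>, \<mu>}\<rbrakk>
      \<Longrightarrow> diag A \<nu> \<mu> = cyl A \<kappa> (diag A \<nu> \<kappa> \<otimes> diag A \<kappa> \<mu>)"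
    and diag_refl: "\<kappa> \<in> Field \<alpha> \<Longrightarrow> diag A \<kappa> \<kappa> = unit A \<one>\<^bsub>M\<^esub>"
    and cyl_diag_delta: "\<lbrakk>\<kappa> \<in> Field \<alpha>; \<nu> \<in> Field \<alpha>; \<kappa> \<noteq> \<nu>; a \<in> carrier A\<rbrakk>
      \<Longrightarrow> cyl A \<kappa> (diag A \<kappa> \<nu> \<otimes> delta A \<one>\<^bsub>M\<^esub> a) \<otimes> cyl A \<kappa> (diag A \<kappa> \<nu> \<otimes> \<sim> (delta A \<one>\<^bsub>M\<^esub> a))
        = unit A \<zero>\<^bsub>M\<^esub>"
    and delta_one_add: "\<lbrakk>a \<in> carrier A; b \<in> carrier A\<rbrakk>
      \<Longrightarrow> delta A \<one>\<^bsub>M\<^esub> (delta A \<one>\<^bsub>M\<^esub> a \<oplus> delta A \<one>\<^bsub>M\<^esub> b) = delta A \<one>\<^bsub>M\<^esub> a \<oplus> delta A \<one>\<^bsub>M\<^esub> b"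
    and delta_one_mult: "\<lbrakk>a \<in> carrier A; b \<in> carrier A\<rbrakk>
      \<Longrightarrow> delta A \<one>\<^bsub>M\<^esub> (delta A \<one>\<^bsub>M\<^esub> a \<otimes> delta A \<one>\<^bsub>M\<^esub> b) = delta A \<one>\<^bsub>M\<^esub> a \<otimes> delta A \<one>\<^bsub>M\<^esub> b"
    and delta_one_neg: "a \<in> carrier A
      \<Longrightarrow> delta A \<one>\<^bsub>M\<^esub> (\<sim> (delta A \<one>\<^bsub>M\<^esub> a)) = \<sim> (delta A \<one>\<^bsub>M\<^esub> a)"
    and delta_one_cyl: "\<lbrakk>\<kappa> \<in> Field \<alpha>; a \<in> carrier A\<rbrakk>
      \<Longrightarrow> delta A \<one>\<^bsub>M\<^esub> (cyl A \<kappa> (delta A \<one>\<^bsub>M\<^esub> a)) = cyl A \<kappa> (delta A \<one>\<^bsub>M\<^esub> a)"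
    and delta_one_diag: "\<lbrakk>\<kappa> \<in> Field \<alpha>; \<nu> \<in> Field \<alpha>\<rbrakk>
      \<Longrightarrow> delta A \<one>\<^bsub>M\<^esub> (diag A \<kappa> \<nu>) = diag A \<kappa> \<nu>"
    and delta_zero_diag: "\<lbrakk>\<kappa> \<in> Field \<alpha>; \<nu> \<in> Field \<alpha>\<rbrakk>
      \<Longrightarrow> delta A \<zero>\<^bsub>M\<^esub> (diag A \<kappa> \<nu>) = \<sim> (diag A \<kappa> \<nu>)"
    and delta_diag_other: "\<lbrakk>\<kappa> \<in> Field \<alpha>; \<nu> \<in> Field \<alpha>; p \<in> carrier M; p \<noteq> \<zero>\<^bsub>M\<^esub>; p \<noteq> \<one>\<^bsub>M\<^esub>\<rbrakk>
      \<Longrightarrow> delta A p (diag A \<kappa> \<nu>) = unit A \<zero>\<^bsub>M\<^esub>"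
    and delta_neg: "\<lbrakk>p \<in> carrier M; a \<in> carrier A\<rbrakk> \<Longrightarrow> delta A p (\<sim> a) = delta A (\<sim>\<^bsub>M\<^esub> p) a"
    and delta_unit_same: "p \<in> carrier M \<Longrightarrow> delta A p (unit A p) = unit A \<one>\<^bsub>M\<^esub>"
    and delta_unit_diff: "\<lbrakk>p \<in> carrier M; q \<in> carrier M; p \<noteq> q\<rbrakk>
      \<Longrightarrow> delta A p (unit A q) = unit A \<zero>\<^bsub>M\<^esub>"
    and delta_disjoint: "\<lbrakk>p \<in> carrier M; q \<in> carrier M; p \<noteq> q; a \<in> carrier A\<rbrakk>
      \<Longrightarrow> delta A p a \<otimes> delta A q a = unit A \<zero>\<^bsub>M\<^esub>"
    and delta_sum: "a \<in> carrier A \<Longrightarrow> finsum A (\<lambda>p. delta A p a) (carrier M) = unit A \<one>\<^bsub>M\<^esub>"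
    and delta_add: "\<lbrakk>p \<in> carrier M; a \<in> carrier A; b \<in> carrier A\<rbrakk>
      \<Longrightarrow> delta A p (a \<oplus> b) = finsum A (\<lambda>(q, r). delta A q a \<otimes> delta A r b) (add_pairs M p)"
    and delta_mult: "\<lbrakk>p \<in> carrier M; a \<in> carrier A; b \<in> carrier A\<rbrakk>
      \<Longrightarrow> delta A p (a \<otimes> b) = finsum A (\<lambda>(q, r). delta A q a \<otimes> delta A r b) (mult_pairs M p)"
    and delta_one_delta: "\<lbrakk>q \<in> carrier M; a \<in> carrier A\<rbrakk>
      \<Longrightarrow> delta A \<one>\<^bsub>M\<^esub> (delta A q a) = delta A q a"
    and delta_delta_other: "\<lbrakk>p \<in> carrier M; q \<in> carrier M; p \<noteq> \<zero>\<^bsub>M\<^esub>; p \<noteq> \<one>\<^bsub>M\<^esub>; a \<in> carrier A\<rbrakk>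
      \<Longrightarrow> delta A p (delta A q a) = unit A \<zero>\<^bsub>M\<^esub>"
    and delta_zero_delta: "\<lbrakk>q \<in> carrier M; a \<in> carrier A\<rbrakk>
      \<Longrightarrow> delta A \<zero>\<^bsub>M\<^esub> (delta A q a) = \<sim> (delta A q a)"
    and delta_ext: "\<lbrakk>a \<in> carrier A; b \<in> carrier A; \<And>p. p \<in> carrier M \<Longrightarrow> delta A p a = delta A p b\<rbrakk>
      \<Longrightarrow> a = b"
    and delta_cyl: "\<lbrakk>p \<in> carrier M; \<kappa> \<in> Field \<alpha>; a \<in> carrier A\<rbrakk>
      \<Longrightarrow> delta A p (cyl A \<kappa> a) =
        finsum A (\<lambda>S. finprod A (\<lambda>q. cyl A \<kappa> (delta A q a)) S) (sets_sup_eq M p) \<otimes>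
        \<sim> (finsum A (\<lambda>S. finprod A (\<lambda>q. cyl A \<kappa> (delta A q a)) S) (sets_sup_gt M p))"


text \<open>
  The algebra \<open>M(B)\<close>. A function from the carrier of \<open>M\<close> to the carrier of \<open>B\<close> is represented by its
  extensional HOL counterpart, hence the restricted abstractions.
\<close>

definition mfun :: "('m, 'y) lattice_alg_scheme \<Rightarrow> ('b, 'k, 'z) cyl_alg_scheme
    \<Rightarrow> ('m \<Rightarrow> 'b, 'k, 'm) mcyl_alg" where
  "mfun M B = \<lparr>
     carrier = {x \<in> carrier M \<rightarrow>\<^sub>E carrier B.
       (\<forall>p \<in> carrier M. \<forall>q \<in> carrier M. p \<noteq> q \<longrightarrow> x p \<otimes>\<^bsub>B\<^esub> x q = \<zero>\<^bsub>B\<^esub>) \<and>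
       finsum B x (carrier M) = \<one>\<^bsub>B\<^esub>},
     mult = (\<lambda>x y. \<lambda>p \<in> carrier M. finsum B (\<lambda>(q, r). x q \<otimes>\<^bsub>B\<^esub> y r) (mult_pairs M p)),
     one = (\<lambda>p \<in> carrier M. if p = \<one>\<^bsub>M\<^esub> then \<one>\<^bsub>B\<^esub> else \<zero>\<^bsub>B\<^esub>),
     zero = (\<lambda>p \<in> carrier M. if p = \<zero>\<^bsub>M\<^esub> then \<one>\<^bsub>B\<^esub> else \<zero>\<^bsub>B\<^esub>),
     add = (\<lambda>x y. \<lambda>p \<in> carrier M. finsum B (\<lambda>(q, r). x q \<otimes>\<^bsub>B\<^esub> y r) (add_pairs M p)),
     neg = (\<lambda>x. \<lambda>p \<in> carrier M. x (\<sim>\<^bsub>M\<^esub> p)),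
     cyl = (\<lambda>\<kappa> x. \<lambda>p \<in> carrier M.
       finsum B (\<lambda>S. finprod B (\<lambda>q. cyl B \<kappa> (x q)) S) (sets_sup_eq M p) \<otimes>\<^bsub>B\<^esub>
       \<sim>\<^bsub>B\<^esub> (finsum B (\<lambda>S. finprod B (\<lambda>q. cyl B \<kappa> (x q)) S) (sets_sup_gt M p))),
     diag = (\<lambda>\<kappa> \<nu>. \<lambda>p \<in> carrier M.
       if p = \<one>\<^bsub>M\<^esub> then diag B \<kappa> \<nu> else if p = \<zero>\<^bsub>M\<^esub> then \<sim>\<^bsub>B\<^esub> (diag B \<kappa> \<nu>) else \<zero>\<^bsub>B\<^esub>),
     unit = (\<lambda>q. \<lambda>p \<in> carrier M. if p = q then \<one>\<^bsub>B\<^esub> else \<zero>\<^bsub>B\<^esub>),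
     delta = (\<lambda>q x. \<lambda>p \<in> carrier M.
       if p = \<one>\<^bsub>M\<^esub> then x q else if p = \<zero>\<^bsub>M\<^esub> then \<sim>\<^bsub>B\<^esub> (x q) else \<zero>\<^bsub>B\<^esub>)\<rparr>"

end

theory Submission
  imports Defs
begin

text \<open>
  Think of the Boolean algebra \<open>B\<close> as the clopen sets of its Stone space, whose points are the
  prime filters \<open>u\<close> of \<open>B\<close>. An element \<open>x\<close> of \<open>M(B)\<close> is a partition of unity indexed by \<open>M\<close>, so
  at each point \<open>u\<close> exactly one component \<open>x p\<close> belongs to \<open>u\<close>; this \<open>p\<close> is the value \<open>val x u\<close>.
  Hence \<open>M(B)\<close> consists of \<open>M\<close>-valued functions on the Stone space, the lattice operations and the
  negation are pointwise (\<open>mfun_add\<close>, \<open>mfun_mult\<close>, \<open>mfun_neg\<close>), and the complicated formula for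
  \<open>c\<^sub>\<kappa>\<close> says that the value of \<open>c\<^sub>\<kappa> x\<close> at \<open>u\<close> is the supremum of the values \<open>q\<close> for which
  \<open>c\<^sub>\<kappa> (x q) \<in> u\<close> (\<open>mfun_cyl\<close>). The laws of distributive lattices follow at once.

  The cylindric laws are inherited from \<open>B\<close> through a second family of maps. A prime filter \<open>J\<close> of
  \<open>M\<close> gives the cut of \<open>x\<close> at \<open>J\<close>, the sum of the components of \<open>x\<close> indexed by \<open>J\<close>; it is the
  set of points at which the value of \<open>x\<close> lies in \<open>J\<close>. Since \<open>J\<close> is prime, a finite supremum lies
  in \<open>J\<close> iff some member does, and since \<open>c\<^sub>\<kappa>\<close> is additive on \<open>B\<close>, the map \<open>cut J\<close> from \<open>M(B)\<close> to
  \<open>B\<close> preserves sums, products and cylindrifications (\<open>cut_add\<close>, \<open>cut_mult\<close>, \<open>cut_cyl\<close>). Prime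
  filters separate the elements of a distributive lattice, so the cuts are jointly injective
  (\<open>eq_by_cuts\<close>): as far as sums, products and cylindrifications are concerned, \<open>M(B)\<close> is a
  subalgebra of a power of \<open>B\<close>, and every identity of \<open>B\<close> in these operations holds in \<open>M(B)\<close>.

  The remaining axioms concern \<open>\<delta>\<^sub>p\<close> and the diagonal elements. Sending \<open>b\<close> to the element with
  value 1 on \<open>b\<close> and 0 off \<open>b\<close> defines an injection \<open>two\<close> of \<open>B\<close> into \<open>M(B)\<close>. It preserves sums,
  products and cylindrifications because every cut of \<open>two b\<close> is \<open>b\<close> again (\<open>cut_two\<close>), and it takes
  complements to negations because negation in \<open>M\<close> swaps 0 and 1. As \<open>\<delta>\<^sub>p x = two (x p)\<close>, and the diagonal
  elements of \<open>M(B)\<close> are the images under \<open>two\<close> of those of \<open>B\<close>, these axioms reduce to identities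
  in \<open>B\<close> between components; extensionality in the \<open>\<delta>\<^sub>p\<close> is the injectivity of \<open>two\<close>.
\<close>

section \<open>Prime filters of bounded distributive lattices\<close>

text \<open>
  The equivalence combines closure under products with upward closure, as \<open>x \<le> y\<close> means
  \<open>x \<otimes> y = x\<close>.
\<close>

definition lattice_filter :: "('a, 'z) ring_scheme \<Rightarrow> 'a set \<Rightarrow> bool" where
  "lattice_filter L F \<longleftrightarrow> F \<subseteq> carrier L \<and> \<one>\<^bsub>L\<^esub> \<in> F \<and>
    (\<forall>x \<in> carrier L. \<forall>y \<in> carrier L. x \<otimes>\<^bsub>L\<^esub> y \<in> F \<longleftrightarrow> x \<in> F \<and> y \<in> F)"

definition prime_filter :: "('a, 'z) ring_scheme \<Rightarrow> 'a set \<Rightarrow> bool" where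
  "prime_filter L P \<longleftrightarrow> lattice_filter L P \<and> \<zero>\<^bsub>L\<^esub> \<notin> P \<and>
    (\<forall>x \<in> carrier L. \<forall>y \<in> carrier L. x \<oplus>\<^bsub>L\<^esub> y \<in> P \<longleftrightarrow> x \<in> P \<or> y \<in> P)"

lemma prime_filter_subset: "prime_filter L P \<Longrightarrow> P \<subseteq> carrier L"
  by (simp add: prime_filter_def lattice_filter_def)

lemma prime_filter_one: "prime_filter L P \<Longrightarrow> \<one>\<^bsub>L\<^esub> \<in> P"
  by (simp add: prime_filter_def lattice_filter_def)

lemma prime_filter_zero: "prime_filter L P \<Longrightarrow> \<zero>\<^bsub>L\<^esub> \<notin> P"
  by (simp add: prime_filter_def)

lemma prime_filter_mult:
  "\<lbrakk>prime_filter L P; x \<in> carrier L; y \<in> carrier L\<rbrakk> \<Longrightarrow> x \<otimes>\<^bsub>L\<^esub> y \<in> P \<longleftrightarrow> x \<in> P \<and> y \<in> P"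
  by (simp add: prime_filter_def lattice_filter_def)

lemma prime_filter_add:
  "\<lbrakk>prime_filter L P; x \<in> carrier L; y \<in> carrier L\<rbrakk> \<Longrightarrow> x \<oplus>\<^bsub>L\<^esub> y \<in> P \<longleftrightarrow> x \<in> P \<or> y \<in> P"
  by (simp add: prime_filter_def)

context bounded_distrib_lattice
begin

lemma mult_idem: assumes "x \<in> carrier L" shows "x \<otimes> x = x"
  using mult_absorb[of x "x \<otimes> x"] add_absorb[of x x] assms by simp

lemma one_filter: "lattice_filter L {\<one>}"
proof -
  have "x = \<one>" if "x \<in> carrier L" "y \<in> carrier L" "x \<otimes> y = \<one>" for x y
  proof -
    have "x = x \<otimes> (x \<otimes> y)" using that by simp
    also have "\<dots> = (x \<otimes> x) \<otimes> y" using that by (simp only: m_assoc)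
    finally show ?thesis using that by (simp add: mult_idem)
  qed
  then show ?thesis unfolding lattice_filter_def using m_comm by (metis insert_subset
    empty_subsetI insert_iff one_closed l_one singletonD)
qed

text \<open>
  The filter generated by \<open>G\<close> and \<open>x\<close>; the equation \<open>(f \<otimes> x) \<otimes> y = f \<otimes> x\<close> says \<open>f \<otimes> x \<le> y\<close>.
\<close>

lemma adjoin_filter:
  assumes G: "lattice_filter L G" and x: "x \<in> carrier L"
  defines "H \<equiv> {y \<in> carrier L. \<exists>f \<in> G. (f \<otimes> x) \<otimes> y = f \<otimes> x}"
  shows "lattice_filter L H" "G \<subseteq> H" "x \<in> H"
proof -
  have Gc: "G \<subseteq> carrier L" and G1: "\<one> \<in> G" using G by (auto simp: lattice_filter_def)
  have GI: "f \<otimes> g \<in> G" if "f \<in> G" "g \<in> G" for f g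
    using that G Gc unfolding lattice_filter_def by blast
  have down: "y \<in> H" if "y \<in> carrier L" "z \<in> carrier L" "y \<otimes> z \<in> H" for y z
  proof -
    obtain f where f: "f \<in> G" "(f \<otimes> x) \<otimes> (y \<otimes> z) = f \<otimes> x"
      using \<open>y \<otimes> z \<in> H\<close> by (auto simp: H_def)
    have fc: "f \<in> carrier L" using f Gc by blast
    have "(f \<otimes> x) \<otimes> y = ((f \<otimes> x) \<otimes> (y \<otimes> z)) \<otimes> y" by (simp only: f)
    also have "\<dots> = (f \<otimes> x) \<otimes> ((y \<otimes> y) \<otimes> z)"
      using that x fc by (simp add: m_ac)
    also have "\<dots> = f \<otimes> x" using f that by (simp add: mult_idem)
    finally show ?thesis using f that by (auto simp: H_def)
  qed
  have up: "y \<otimes> z \<in> H" if "y \<in> H" "z \<in> H" for y z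
  proof -
    obtain f g where f: "f \<in> G" "(f \<otimes> x) \<otimes> y = f \<otimes> x"
      and g: "g \<in> G" "(g \<otimes> x) \<otimes> z = g \<otimes> x" and yz: "y \<in> carrier L" "z \<in> carrier L"
      using \<open>y \<in> H\<close> \<open>z \<in> H\<close> by (auto simp: H_def)
    have c: "f \<in> carrier L" "g \<in> carrier L" using f g Gc by blast+
    have *: "(f \<otimes> g) \<otimes> x = (f \<otimes> x) \<otimes> (g \<otimes> x)"
    proof -
      have "(f \<otimes> g) \<otimes> x = (f \<otimes> g) \<otimes> (x \<otimes> x)" using x by (simp add: mult_idem)
      also have "\<dots> = (f \<otimes> x) \<otimes> (g \<otimes> x)" using x c by (simp add: m_ac)
      finally show ?thesis .
    qed
    have "((f \<otimes> g) \<otimes> x) \<otimes> (y \<otimes> z) = ((f \<otimes> x) \<otimes> y) \<otimes> ((g \<otimes> x) \<otimes> z)"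
      unfolding * using x c yz by (simp add: m_ac)
    also have "\<dots> = (f \<otimes> g) \<otimes> x" by (simp only: f g *)
    finally show ?thesis using GI[OF f(1) g(1)] yz by (auto simp: H_def)
  qed
  have Hc: "H \<subseteq> carrier L" by (auto simp: H_def)
  have "\<one> \<in> H" using G1 x by (auto simp: H_def intro!: bexI[of _ \<one>])
  then show "lattice_filter L H"
    unfolding lattice_filter_def using down up Hc m_comm by metis
  show "G \<subseteq> H"
  proof
    fix g assume g: "g \<in> G"
    then have "g \<in> carrier L" using Gc by blast
    then have "(g \<otimes> x) \<otimes> g = (g \<otimes> g) \<otimes> x" using x by (simp add: m_ac)
    also have "\<dots> = g \<otimes> x" using \<open>g \<in> carrier L\<close> by (simp add: mult_idem)
    finally show "g \<in> H" using g \<open>g \<in> carrier L\<close> by (auto simp: H_def)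
  qed
  show "x \<in> H" using G1 x by (auto simp: H_def mult_idem intro!: bexI[of _ \<one>])
qed

text \<open>
  By Zorn's lemma there is a filter \<open>P\<close> maximal among those containing \<open>a\<close> but not \<open>b\<close>. If
  \<open>x \<oplus> y \<in> P\<close> with \<open>x, y \<notin> P\<close>, then by maximality adjoining \<open>x\<close> or \<open>y\<close> to \<open>P\<close> produces \<open>b\<close>,
  so \<open>f \<otimes> x \<le> b\<close> and \<open>g \<otimes> y \<le> b\<close> for some \<open>f, g \<in> P\<close>. By distributivity
  \<open>(f \<otimes> g) \<otimes> (x \<oplus> y) \<le> b\<close>, whence \<open>b \<in> P\<close>, a contradiction. The hypothesis
  \<open>a \<otimes> b \<noteq> a\<close> says that \<open>a \<le> b\<close> fails.
\<close>

lemma prime_filter_separation: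
  assumes a: "a \<in> carrier L" and b: "b \<in> carrier L" and ab: "a \<otimes> b \<noteq> a"
  obtains P where "prime_filter L P" "a \<in> P" "b \<notin> P"
proof -
  define C where "C = {F. lattice_filter L F \<and> a \<in> F \<and> b \<notin> F}"
  have "{y \<in> carrier L. \<exists>f \<in> {\<one>}. (f \<otimes> a) \<otimes> y = f \<otimes> a} \<in> C"
    using adjoin_filter[OF one_filter a] a ab by (auto simp: C_def)
  then have "C \<noteq> {}" by blast
  moreover have "\<Union>\<C> \<in> C" if "\<C> \<noteq> {}" "subset.chain C \<C>" for \<C>
  proof -
    have F: "lattice_filter L F" "a \<in> F" "b \<notin> F" if "F \<in> \<C>" for F
      using that \<open>subset.chain C \<C>\<close> by (auto simp: C_def subset.chain_def)
    have chain: "F \<subseteq> G \<or> G \<subseteq> F" if "F \<in> \<C>" "G \<in> \<C>" for F G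
      using that \<open>subset.chain C \<C>\<close> by (auto simp: subset_chain_def)
    have "x \<otimes> y \<in> \<Union>\<C> \<longleftrightarrow> x \<in> \<Union>\<C> \<and> y \<in> \<Union>\<C>"
      if "x \<in> carrier L" "y \<in> carrier L" for x y
    proof
      show "x \<in> \<Union>\<C> \<and> y \<in> \<Union>\<C>" if "x \<otimes> y \<in> \<Union>\<C>"
        using that F(1) \<open>x \<in> carrier L\<close> \<open>y \<in> carrier L\<close> unfolding lattice_filter_def by blast
      assume "x \<in> \<Union>\<C> \<and> y \<in> \<Union>\<C>"
      then obtain F G where "F \<in> \<C>" "x \<in> F" "G \<in> \<C>" "y \<in> G" by blast
      then obtain H where "H \<in> \<C>" "x \<in> H" "y \<in> H" using chain by blast
      then show "x \<otimes> y \<in> \<Union>\<C>"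
        using F(1) that unfolding lattice_filter_def by blast
    qed
    moreover have "\<Union>\<C> \<subseteq> carrier L" "\<one> \<in> \<Union>\<C>"
      using F(1) \<open>\<C> \<noteq> {}\<close> unfolding lattice_filter_def by blast+
    ultimately have "lattice_filter L (\<Union>\<C>)" by (simp add: lattice_filter_def)
    then show ?thesis using F(2,3) \<open>\<C> \<noteq> {}\<close> by (auto simp: C_def)
  qed
  ultimately obtain P where P: "P \<in> C" and max: "\<And>X. \<lbrakk>X \<in> C; P \<subseteq> X\<rbrakk> \<Longrightarrow> X = P"
    using subset_Zorn_nonempty[of C] by blast
  have fil: "lattice_filter L P" and aP: "a \<in> P" and bP: "b \<notin> P"
    using P by (auto simp: C_def)
  have Pm: "x \<otimes> y \<in> P \<longleftrightarrow> x \<in> P \<and> y \<in> P" if "x \<in> carrier L" "y \<in> carrier L" for x y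
    using fil that unfolding lattice_filter_def by blast+
  have Pc: "P \<subseteq> carrier L" using fil by (simp add: lattice_filter_def)
  have below: "\<exists>f \<in> P. (f \<otimes> x) \<otimes> b = f \<otimes> x" if x: "x \<in> carrier L" "x \<notin> P" for x
  proof (rule ccontr)
    assume "\<not> ?thesis"
    then have "{y \<in> carrier L. \<exists>f \<in> P. (f \<otimes> x) \<otimes> y = f \<otimes> x} \<in> C"
      using adjoin_filter(1,2)[OF fil x(1)] aP by (auto simp: C_def)
    then have "{y \<in> carrier L. \<exists>f \<in> P. (f \<otimes> x) \<otimes> y = f \<otimes> x} = P"
      using max adjoin_filter(2)[OF fil x(1)] by blast
    then show False using adjoin_filter(3)[OF fil x(1)] x(2) by blast
  qed
  have "x \<in> P \<or> y \<in> P" if xy: "x \<in> carrier L" "y \<in> carrier L" "x \<oplus> y \<in> P" for x y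
  proof (rule ccontr)
    assume "\<not> ?thesis"
    then obtain f g where f: "f \<in> P" "(f \<otimes> x) \<otimes> b = f \<otimes> x" and g: "g \<in> P" "(g \<otimes> y) \<otimes> b = g \<otimes> y"
      using below xy by blast
    have c: "f \<in> carrier L" "g \<in> carrier L" using f g Pc by blast+
    define h where "h = f \<otimes> g"
    have h: "h \<in> carrier L" "h \<in> P" using f g c Pm by (auto simp: h_def)
    have hx: "b \<otimes> (h \<otimes> x) = h \<otimes> x"
    proof -
      have "b \<otimes> (h \<otimes> x) = g \<otimes> ((f \<otimes> x) \<otimes> b)" unfolding h_def using c xy b by (simp add: m_ac)
      also have "\<dots> = h \<otimes> x" unfolding f h_def using c xy by (simp add: m_ac)
      finally show ?thesis .
    qed
    have hy: "b \<otimes> (h \<otimes> y) = h \<otimes> y"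
    proof -
      have "b \<otimes> (h \<otimes> y) = f \<otimes> ((g \<otimes> y) \<otimes> b)" unfolding h_def using c xy b by (simp add: m_ac)
      also have "\<dots> = h \<otimes> y" unfolding g h_def using c xy by (simp add: m_ac)
      finally show ?thesis .
    qed
    have "b \<otimes> (h \<otimes> (x \<oplus> y)) = h \<otimes> (x \<oplus> y)"
      using hx hy h xy b by (simp add: mult_add_distrib)
    moreover have "h \<otimes> (x \<oplus> y) \<in> P" using Pm h xy by simp
    ultimately have "b \<in> P" using Pm[of b "h \<otimes> (x \<oplus> y)"] b h xy by simp
    with bP show False ..
  qed
  moreover have "x \<oplus> y \<in> P" if "x \<in> carrier L" "y \<in> carrier L" "x \<in> P" for x y
    using Pm[of x "x \<oplus> y"] mult_absorb[of x y] that by simp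
  then have "x \<oplus> y \<in> P" if "x \<in> carrier L" "y \<in> carrier L" "x \<in> P \<or> y \<in> P" for x y
    using that a_comm by metis
  moreover have "\<zero> \<notin> P"
  proof
    assume "\<zero> \<in> P"
    moreover have "\<zero> \<otimes> b = \<zero>" using mult_absorb[of \<zero> b] b by simp
    ultimately show False using Pm[of \<zero> b] b bP by simp
  qed
  ultimately have "prime_filter L P" unfolding prime_filter_def using fil by blast
  then show ?thesis using aP bP that by blast
qed

text \<open>
  This turns an identity in a distributive lattice into a propositional statement about membership
  in an arbitrary prime filter. It is applied both to \<open>B\<close> and to \<open>M\<close>.
\<close>

lemma eq_by_prime_filters:
  assumes x: "x \<in> carrier L" and y: "y \<in> carrier L"
    and *: "\<And>P. prime_filter L P \<Longrightarrow> x \<in> P \<longleftrightarrow> y \<in> P"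
  shows "x = y"
proof -
  have "x \<otimes> y = x" using prime_filter_separation[OF x y] * by blast
  moreover have "y \<otimes> x = y" using prime_filter_separation[OF y x] * by blast
  ultimately show ?thesis using m_comm x y by simp
qed

lemma prime_filter_finsum:
  assumes P: "prime_filter L P" and "finite S" and "f \<in> S \<rightarrow> carrier L"
  shows "finsum L f S \<in> P \<longleftrightarrow> (\<exists>s \<in> S. f s \<in> P)"
  using assms(2,3)
proof (induction S)
  case empty
  then show ?case using prime_filter_zero[OF P] by simp
next
  case (insert s S)
  then have "f s \<in> carrier L" "f \<in> S \<rightarrow> carrier L" by auto
  then show ?case using insert by (simp add: finsum_closed prime_filter_add[OF P])
qed

lemma prime_filter_finprod:
  assumes P: "prime_filter L P" and "finite S" and "f \<in> S \<rightarrow> carrier L"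
  shows "finprod L f S \<in> P \<longleftrightarrow> (\<forall>s \<in> S. f s \<in> P)"
  using assms(2,3)
proof (induction S)
  case empty
  then show ?case using prime_filter_one[OF P] by simp
next
  case (insert s S)
  then have "f s \<in> carrier L" "f \<in> S \<rightarrow> carrier L" by auto
  then show ?case using insert by (simp add: finprod_closed prime_filter_mult[OF P])
qed

end

lemma (in boolean_alg) prime_filter_compl:
  assumes P: "prime_filter B P" and x: "x \<in> carrier B"
  shows "\<sim> x \<in> P \<longleftrightarrow> x \<notin> P"
  using prime_filter_mult[OF P x compl_closed[OF x]] prime_filter_add[OF P x compl_closed[OF x]]
    prime_filter_one[OF P] prime_filter_zero[OF P] mult_compl[OF x] add_compl[OF x] by auto

lemma (in finite_de_morgan_algebra) neg_zero: "\<sim> \<zero> = \<one>"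
  using neg_add[of "\<sim> \<one>" \<zero>] neg_neg[of \<one>] neg_closed[of \<one>] neg_closed[of \<zero>] by simp

lemma (in finite_de_morgan_algebra) neg_one: "\<sim> \<one> = \<zero>"
  using neg_neg[of \<zero>] neg_zero by simp

section \<open>Additivity of cylindrifications\<close>

context cylindric_algebra
begin

text \<open>
  With \<open>y = \<sim> c x\<close> one has \<open>c y \<otimes> c x = c (y \<otimes> c x) = c \<zero> = \<zero>\<close>, that is, \<open>c y \<le> y\<close>.
\<close>

lemma cyl_compl_cyl:
  assumes k: "\<kappa> \<in> Field \<alpha>" and x: "x \<in> carrier B"
  shows "cyl B \<kappa> (\<sim> (cyl B \<kappa> x)) = \<sim> (cyl B \<kappa> x)"
proof -
  define y where "y = \<sim> (cyl B \<kappa> x)"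
  have c: "cyl B \<kappa> x \<in> carrier B" "y \<in> carrier B" "cyl B \<kappa> y \<in> carrier B"
    using k x by (auto simp: y_def intro: cyl_closed compl_closed)
  have "cyl B \<kappa> y \<otimes> cyl B \<kappa> x = cyl B \<kappa> (y \<otimes> cyl B \<kappa> x)" using cyl_mult_cyl k x c by simp
  also have "\<dots> = \<zero>" using mult_compl[of "cyl B \<kappa> x"] m_comm c cyl_zero k by (simp add: y_def)
  finally have disj: "cyl B \<kappa> y \<otimes> cyl B \<kappa> x = \<zero>" .
  have ge: "y \<otimes> cyl B \<kappa> y = y" using cyl_ge[OF k c(2)] by (simp add: lle_def)
  have "cyl B \<kappa> y = y"
  proof (rule eq_by_prime_filters)
    fix P assume P: "prime_filter B P"
    show "cyl B \<kappa> y \<in> P \<longleftrightarrow> y \<in> P"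
      using prime_filter_mult[OF P c(3,1)] prime_filter_mult[OF P c(2,3)] disj ge
        prime_filter_zero[OF P] prime_filter_compl[OF P c(1)] by (auto simp: y_def)
  qed (use c in auto)
  then show ?thesis by (simp add: y_def)
qed

lemma cyl_fixed_compl:
  assumes k: "\<kappa> \<in> Field \<alpha>" and x: "x \<in> carrier B" and "cyl B \<kappa> x = x"
  shows "cyl B \<kappa> (\<sim> x) = \<sim> x"
  using cyl_compl_cyl[OF k x] assms by simp

lemma cyl_le_cyl:
  assumes k: "\<kappa> \<in> Field \<alpha>" and xy: "x \<in> carrier B" "y \<in> carrier B" "x \<otimes> cyl B \<kappa> y = x"
  shows "cyl B \<kappa> x \<otimes> cyl B \<kappa> y = cyl B \<kappa> x"
  using cyl_mult_cyl[OF k xy(1,2)] xy by simp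

text \<open>
  The fixed points of \<open>c\<close> are closed under products and complements, hence \<open>c x \<oplus> c y\<close> is a fixed
  point; it lies above \<open>x \<oplus> y\<close>, and so above \<open>c (x \<oplus> y)\<close>. The other inequality is monotonicity.
\<close>

lemma cyl_add:
  assumes k: "\<kappa> \<in> Field \<alpha>" and x: "x \<in> carrier B" and y: "y \<in> carrier B"
  shows "cyl B \<kappa> (x \<oplus> y) = cyl B \<kappa> x \<oplus> cyl B \<kappa> y"
proof -
  define a where "a = \<sim> (cyl B \<kappa> x)"
  define b where "b = \<sim> (cyl B \<kappa> y)"
  have c: "cyl B \<kappa> x \<in> carrier B" "cyl B \<kappa> y \<in> carrier B" "a \<in> carrier B" "b \<in> carrier B"
    using assms by (auto simp: a_def b_def intro: cyl_closed compl_closed)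
  have [simp]: "a \<otimes> b \<in> carrier B" "x \<oplus> y \<in> carrier B" "cyl B \<kappa> x \<oplus> cyl B \<kappa> y \<in> carrier B"
    "cyl B \<kappa> (x \<oplus> y) \<in> carrier B"
    using c assms by (auto intro: cyl_closed)
  have z: "cyl B \<kappa> x \<oplus> cyl B \<kappa> y = \<sim> (a \<otimes> b)"
  proof (rule eq_by_prime_filters)
    fix P assume P: "prime_filter B P"
    show "cyl B \<kappa> x \<oplus> cyl B \<kappa> y \<in> P \<longleftrightarrow> \<sim> (a \<otimes> b) \<in> P"
      using c by (simp add: prime_filter_add[OF P] prime_filter_compl[OF P]
          prime_filter_mult[OF P]) (auto simp: a_def b_def prime_filter_compl[OF P])
  qed (use c in \<open>auto intro: compl_closed\<close>)
  have fixb: "cyl B \<kappa> b = b" using cyl_compl_cyl k y by (simp add: b_def)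
  have fixa: "cyl B \<kappa> a = a" using cyl_compl_cyl k x by (simp add: a_def)
  have "cyl B \<kappa> (a \<otimes> b) = a \<otimes> b"
    using cyl_mult_cyl[OF k c(3,4)] unfolding fixa fixb .
  then have closed: "cyl B \<kappa> (cyl B \<kappa> x \<oplus> cyl B \<kappa> y) = cyl B \<kappa> x \<oplus> cyl B \<kappa> y"
    unfolding z using cyl_fixed_compl[OF k] by simp
  have gex: "x \<otimes> cyl B \<kappa> x = x" and gey: "y \<otimes> cyl B \<kappa> y = y"
    using cyl_ge k x y by (auto simp: lle_def)
  have "(x \<oplus> y) \<otimes> (cyl B \<kappa> x \<oplus> cyl B \<kappa> y) = x \<oplus> y"
  proof (rule eq_by_prime_filters)
    fix P assume P: "prime_filter B P"
    show "(x \<oplus> y) \<otimes> (cyl B \<kappa> x \<oplus> cyl B \<kappa> y) \<in> P \<longleftrightarrow> x \<oplus> y \<in> P"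
      using prime_filter_mult[OF P x c(1)] prime_filter_mult[OF P y c(2)] gex gey c x y
      by (auto simp: prime_filter_add[OF P] prime_filter_mult[OF P])
  qed (use c x y in auto)
  then have le: "cyl B \<kappa> (x \<oplus> y) \<otimes> (cyl B \<kappa> x \<oplus> cyl B \<kappa> y) = cyl B \<kappa> (x \<oplus> y)"
    using cyl_le_cyl[OF k, of "x \<oplus> y" "cyl B \<kappa> x \<oplus> cyl B \<kappa> y"] closed by simp
  have sub: "cyl B \<kappa> w \<otimes> cyl B \<kappa> (x \<oplus> y) = cyl B \<kappa> w" if w: "w \<in> {x, y}" for w
  proof (rule cyl_le_cyl[OF k])
    show wc: "w \<in> carrier B" "x \<oplus> y \<in> carrier B" using w x y by auto
    show "w \<otimes> cyl B \<kappa> (x \<oplus> y) = w"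
    proof (rule eq_by_prime_filters)
      fix P assume P: "prime_filter B P"
      have "(x \<oplus> y) \<otimes> cyl B \<kappa> (x \<oplus> y) = x \<oplus> y" using cyl_ge[OF k wc(2)] by (simp add: lle_def)
      then show "w \<otimes> cyl B \<kappa> (x \<oplus> y) \<in> P \<longleftrightarrow> w \<in> P"
        using prime_filter_mult[OF P wc(2), of "cyl B \<kappa> (x \<oplus> y)"] wc w x y
        by (auto simp: prime_filter_mult[OF P] prime_filter_add[OF P])
    qed (use wc in auto)
  qed
  show ?thesis
  proof (rule eq_by_prime_filters)
    fix P assume P: "prime_filter B P"
    show "cyl B \<kappa> (x \<oplus> y) \<in> P \<longleftrightarrow> cyl B \<kappa> x \<oplus> cyl B \<kappa> y \<in> P"
      using le sub[of x] sub[of y] c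
        prime_filter_mult[OF P, of "cyl B \<kappa> (x \<oplus> y)" "cyl B \<kappa> x \<oplus> cyl B \<kappa> y"]
        prime_filter_mult[OF P c(1), of "cyl B \<kappa> (x \<oplus> y)"]
        prime_filter_mult[OF P c(2), of "cyl B \<kappa> (x \<oplus> y)"]
      by (auto simp: prime_filter_add[OF P])
  qed auto
qed

lemma cyl_finsum:
  assumes k: "\<kappa> \<in> Field \<alpha>" and "finite S" and "f \<in> S \<rightarrow> carrier B"
  shows "cyl B \<kappa> (finsum B f S) = finsum B (\<lambda>s. cyl B \<kappa> (f s)) S"
  using assms(2,3)
proof (induction S)
  case empty
  then show ?case using cyl_zero k by simp
next
  case (insert s S)
  then have "f s \<in> carrier B" "f \<in> S \<rightarrow> carrier B" by auto
  moreover from this have "(\<lambda>s. cyl B \<kappa> (f s)) \<in> S \<rightarrow> carrier B" "cyl B \<kappa> (f s) \<in> carrier B"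
    using cyl_closed k by auto
  ultimately show ?case using insert k by (simp add: finsum_closed cyl_add)
qed

end

section \<open>Elements as functions on points\<close>

lemma finite_sets_sup_eq: "finite (carrier M) \<Longrightarrow> finite (sets_sup_eq M p)"
  by (rule finite_subset[of _ "Pow (carrier M)"]) (auto simp: sets_sup_eq_def)

lemma finite_sets_sup_gt: "finite (carrier M) \<Longrightarrow> finite (sets_sup_gt M p)"
  by (rule finite_subset[of _ "Pow (carrier M)"]) (auto simp: sets_sup_gt_def)

context finite_de_morgan_algebra
begin

lemma lsup_prime_filter:
  assumes "prime_filter M J" and "S \<subseteq> carrier M"
  shows "lsup M S \<in> J \<longleftrightarrow> (\<exists>q \<in> S. q \<in> J)"
  unfolding lsup_def
  by (rule prime_filter_finsum[OF assms(1) finite_subset[OF assms(2) finite_carrier]])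
    (use assms(2) in blast)

lemma lsup_closed: "S \<subseteq> carrier M \<Longrightarrow> lsup M S \<in> carrier M"
  unfolding lsup_def by (intro finsum_closed) auto

lemma lsup_mono:
  assumes "S \<subseteq> T" and "T \<subseteq> carrier M"
  shows "lle M (lsup M S) (lsup M T)"
  unfolding lle_def
proof (rule eq_by_prime_filters)
  fix J assume J: "prime_filter M J"
  show "lsup M S \<otimes> lsup M T \<in> J \<longleftrightarrow> lsup M S \<in> J"
    using J assms by (auto simp: prime_filter_mult lsup_closed lsup_prime_filter)
qed (use assms in \<open>auto intro: lsup_closed m_closed\<close>)

text \<open>
  The combinatorial content of the definition of \<open>c\<close> in \<open>M(B)\<close>. With \<open>V\<close> the set of all \<open>q\<close>
  such that \<open>c (x q)\<close> contains a given point, the left-hand side says that the component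
  \<open>(c x) p\<close> contains that point: \<open>p\<close> is the supremum of some nonempty subset of \<open>V\<close>, and no
  nonempty subset of \<open>V\<close> has a larger one. As \<open>V\<close> itself has the largest supremum, this forces
  \<open>p\<close> to be that supremum.
\<close>

lemma lsup_unique:
  assumes V: "V \<subseteq> carrier M" "V \<noteq> {}" and p: "p \<in> carrier M"
  shows "(\<exists>S \<in> sets_sup_eq M p. S \<subseteq> V) \<and> \<not> (\<exists>S \<in> sets_sup_gt M p. S \<subseteq> V) \<longleftrightarrow> p = lsup M V"
proof
  assume *: "(\<exists>S \<in> sets_sup_eq M p. S \<subseteq> V) \<and> \<not> (\<exists>S \<in> sets_sup_gt M p. S \<subseteq> V)"
  then have "lle M p (lsup M V)" using lsup_mono V by (auto simp: sets_sup_eq_def)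
  moreover have "V \<notin> sets_sup_gt M p" using * by blast
  ultimately show "p = lsup M V" using V by (auto simp: sets_sup_gt_def)
next
  assume pV: "p = lsup M V"
  then have "V \<in> sets_sup_eq M p" using V by (simp add: sets_sup_eq_def)
  moreover have False if S: "S \<in> sets_sup_gt M p" "S \<subseteq> V" for S
  proof -
    have "lle M (lsup M S) p" "lle M p (lsup M S)" "p \<noteq> lsup M S"
      using lsup_mono[OF S(2) V(1)] S pV by (auto simp: sets_sup_gt_def)
    moreover have "lsup M S \<in> carrier M" using S V lsup_closed by blast
    ultimately show False using m_comm[of p "lsup M S"] p by (simp add: lle_def)
  qed
  ultimately show "(\<exists>S \<in> sets_sup_eq M p. S \<subseteq> V) \<and> \<not> (\<exists>S \<in> sets_sup_gt M p. S \<subseteq> V)" by blast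
qed

end

locale mfun_algebra = M: finite_de_morgan_algebra M + B: cylindric_algebra B \<alpha>
  for M :: "('m, 'y) lattice_alg_scheme" and B :: "('b, 'k, 'z) cyl_alg_scheme"
    and \<alpha> :: "'k rel"
begin

abbreviation F :: "('m \<Rightarrow> 'b, 'k, 'm) mcyl_alg" where "F \<equiv> mfun M B"

text \<open>
  The value of \<open>x\<close> at the point \<open>u\<close>; it is well defined by \<open>component_unique\<close> below.
\<close>

definition val :: "('m \<Rightarrow> 'b) \<Rightarrow> 'b set \<Rightarrow> 'm" where
  "val x u = (THE p. p \<in> carrier M \<and> x p \<in> u)"

lemma mfun_funcset: "x \<in> carrier F \<Longrightarrow> x \<in> carrier M \<rightarrow>\<^sub>E carrier B"
  by (simp add: mfun_def)

lemma component_closed: "\<lbrakk>x \<in> carrier F; p \<in> carrier M\<rbrakk> \<Longrightarrow> x p \<in> carrier B"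
  using mfun_funcset by blast

lemma component_unique:
  assumes x: "x \<in> carrier F" and u: "prime_filter B u"
  shows "\<exists>!p. p \<in> carrier M \<and> x p \<in> u"
proof -
  have "finsum B x (carrier M) \<in> u" using x prime_filter_one[OF u] by (simp add: mfun_def)
  then have "\<exists>p \<in> carrier M. x p \<in> u"
    using B.prime_filter_finsum[OF u M.finite_carrier, of x] component_closed[OF x] by auto
  moreover have "p = q" if "p \<in> carrier M" "q \<in> carrier M" "x p \<in> u" "x q \<in> u" for p q
  proof (rule ccontr)
    assume "p \<noteq> q"
    then have "x p \<otimes>\<^bsub>B\<^esub> x q = \<zero>\<^bsub>B\<^esub>" using that x by (simp add: mfun_def)
    then show False
      using prime_filter_mult[OF u, of "x p" "x q"] prime_filter_zero[OF u]
        component_closed[OF x] that by simp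
  qed
  ultimately show ?thesis by blast
qed

lemma val_closed: "\<lbrakk>x \<in> carrier F; prime_filter B u\<rbrakk> \<Longrightarrow> val x u \<in> carrier M"
  unfolding val_def using theI'[OF component_unique] by blast

lemma component_iff_val:
  "\<lbrakk>x \<in> carrier F; prime_filter B u; p \<in> carrier M\<rbrakk> \<Longrightarrow> x p \<in> u \<longleftrightarrow> p = val x u"
  unfolding val_def using component_unique theI'[OF component_unique, of x u] by blast

text \<open>
  Conversely, a family of elements of \<open>B\<close> is in \<open>M(B)\<close> as soon as every point lies in exactly one
  of its members. Closure of \<open>M(B)\<close> under each operation is proved this way, together with the
  values of the result.
\<close>

lemma mfun_by_val:
  assumes x: "x \<in> carrier M \<rightarrow>\<^sub>E carrier B"
    and v: "\<And>u. prime_filter B u \<Longrightarrow> v u \<in> carrier M"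
    and xv: "\<And>u p. \<lbrakk>prime_filter B u; p \<in> carrier M\<rbrakk> \<Longrightarrow> x p \<in> u \<longleftrightarrow> p = v u"
  shows mfun_memI: "x \<in> carrier F" and val_eqI: "prime_filter B u \<Longrightarrow> val x u = v u"
proof -
  have c: "x p \<in> carrier B" if "p \<in> carrier M" for p using x that by blast
  have "x p \<otimes>\<^bsub>B\<^esub> x q = \<zero>\<^bsub>B\<^esub>" if pq: "p \<in> carrier M" "q \<in> carrier M" "p \<noteq> q" for p q
  proof (rule B.eq_by_prime_filters)
    fix u assume u: "prime_filter B u"
    show "x p \<otimes>\<^bsub>B\<^esub> x q \<in> u \<longleftrightarrow> \<zero>\<^bsub>B\<^esub> \<in> u"
      using pq c u by (auto simp: prime_filter_mult prime_filter_zero xv)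
  qed (use c pq in auto)
  moreover have "finsum B x (carrier M) = \<one>\<^bsub>B\<^esub>"
  proof (rule B.eq_by_prime_filters)
    fix u assume u: "prime_filter B u"
    show "finsum B x (carrier M) \<in> u \<longleftrightarrow> \<one>\<^bsub>B\<^esub> \<in> u"
      using B.prime_filter_finsum[OF u M.finite_carrier, of x] c v[OF u] xv[OF u]
        prime_filter_one[OF u] by auto
  qed (use c in \<open>auto intro: B.finsum_closed\<close>)
  ultimately show mem: "x \<in> carrier F" using x by (simp add: mfun_def)
  show "val x u = v u" if u: "prime_filter B u"
    using component_iff_val[OF mem u v[OF u]] xv[OF u v[OF u]] by simp
qed

lemma eq_by_val:
  assumes x: "x \<in> carrier F" and y: "y \<in> carrier F"
    and *: "\<And>u. prime_filter B u \<Longrightarrow> val x u = val y u"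
  shows "x = y"
proof (rule PiE_ext[OF mfun_funcset[OF x] mfun_funcset[OF y]])
  fix p assume p: "p \<in> carrier M"
  show "x p = y p"
    by (rule B.eq_by_prime_filters)
      (use p x y * in \<open>auto simp: component_closed component_iff_val\<close>)
qed

subsection \<open>The operations at a point\<close>

lemma add_component:
  "p \<in> carrier M \<Longrightarrow> (x \<oplus>\<^bsub>F\<^esub> y) p = finsum B (\<lambda>(q, r). x q \<otimes>\<^bsub>B\<^esub> y r) (add_pairs M p)"
  by (simp add: mfun_def)

lemma mult_component:
  "p \<in> carrier M \<Longrightarrow> (x \<otimes>\<^bsub>F\<^esub> y) p = finsum B (\<lambda>(q, r). x q \<otimes>\<^bsub>B\<^esub> y r) (mult_pairs M p)"
  by (simp add: mfun_def)

lemma add_pairs_subset: "add_pairs M p \<subseteq> carrier M \<times> carrier M"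
  by (auto simp: add_pairs_def)

lemma mult_pairs_subset: "mult_pairs M p \<subseteq> carrier M \<times> carrier M"
  by (auto simp: mult_pairs_def)

text \<open>
  The form shared by the components of sums and of products in \<open>M(B)\<close>.
\<close>

lemma pair_sum:
  assumes x: "x \<in> carrier F" and y: "y \<in> carrier F" and T: "T \<subseteq> carrier M \<times> carrier M"
  shows pair_sum_closed: "finsum B (\<lambda>(q, r). x q \<otimes>\<^bsub>B\<^esub> y r) T \<in> carrier B"
    and pair_sum_iff_val: "prime_filter B u \<Longrightarrow>
      finsum B (\<lambda>(q, r). x q \<otimes>\<^bsub>B\<^esub> y r) T \<in> u \<longleftrightarrow> (val x u, val y u) \<in> T"
proof -
  let ?f = "\<lambda>(q, r). x q \<otimes>\<^bsub>B\<^esub> y r"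
  have f: "?f \<in> T \<rightarrow> carrier B" using x y T by (auto simp: component_closed)
  then show "finsum B ?f T \<in> carrier B" by (rule B.finsum_closed)
  assume u: "prime_filter B u"
  have "finite T" using T M.finite_carrier by (blast intro: finite_subset)
  then have "finsum B ?f T \<in> u \<longleftrightarrow> (\<exists>s \<in> T. ?f s \<in> u)"
    by (rule B.prime_filter_finsum[OF u _ f])
  also have "\<dots> \<longleftrightarrow> (\<exists>(q, r) \<in> T. q = val x u \<and> r = val y u)"
    using x y T by (intro bex_cong refl)
      (auto simp: prime_filter_mult[OF u] component_closed component_iff_val u)
  finally show "finsum B ?f T \<in> u \<longleftrightarrow> (val x u, val y u) \<in> T" by auto
qed

lemma mfun_add:
  assumes x: "x \<in> carrier F" and y: "y \<in> carrier F"
  shows add_closed: "x \<oplus>\<^bsub>F\<^esub> y \<in> carrier F"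
    and val_add: "prime_filter B u \<Longrightarrow> val (x \<oplus>\<^bsub>F\<^esub> y) u = val x u \<oplus>\<^bsub>M\<^esub> val y u"
proof -
  note T = add_pairs_subset
  have "x \<oplus>\<^bsub>F\<^esub> y \<in> carrier M \<rightarrow>\<^sub>E carrier B"
    using pair_sum_closed[OF x y T] by (simp add: mfun_def)
  moreover have "(x \<oplus>\<^bsub>F\<^esub> y) p \<in> u \<longleftrightarrow> p = val x u \<oplus>\<^bsub>M\<^esub> val y u"
    if "prime_filter B u" "p \<in> carrier M" for u p
    using pair_sum_iff_val[OF x y T, of u p] val_closed x y that by (auto simp: add_component add_pairs_def)
  ultimately show "x \<oplus>\<^bsub>F\<^esub> y \<in> carrier F"
    and "prime_filter B u \<Longrightarrow> val (x \<oplus>\<^bsub>F\<^esub> y) u = val x u \<oplus>\<^bsub>M\<^esub> val y u"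
    using mfun_by_val[of "x \<oplus>\<^bsub>F\<^esub> y" "\<lambda>u. val x u \<oplus>\<^bsub>M\<^esub> val y u"] val_closed x y by auto
qed

lemma mfun_mult:
  assumes x: "x \<in> carrier F" and y: "y \<in> carrier F"
  shows mult_closed: "x \<otimes>\<^bsub>F\<^esub> y \<in> carrier F"
    and val_mult: "prime_filter B u \<Longrightarrow> val (x \<otimes>\<^bsub>F\<^esub> y) u = val x u \<otimes>\<^bsub>M\<^esub> val y u"
proof -
  note T = mult_pairs_subset
  have "x \<otimes>\<^bsub>F\<^esub> y \<in> carrier M \<rightarrow>\<^sub>E carrier B"
    using pair_sum_closed[OF x y T] by (simp add: mfun_def)
  moreover have "(x \<otimes>\<^bsub>F\<^esub> y) p \<in> u \<longleftrightarrow> p = val x u \<otimes>\<^bsub>M\<^esub> val y u"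
    if "prime_filter B u" "p \<in> carrier M" for u p
    using pair_sum_iff_val[OF x y T, of u p] val_closed x y that by (auto simp: mult_component mult_pairs_def)
  ultimately show "x \<otimes>\<^bsub>F\<^esub> y \<in> carrier F"
    and "prime_filter B u \<Longrightarrow> val (x \<otimes>\<^bsub>F\<^esub> y) u = val x u \<otimes>\<^bsub>M\<^esub> val y u"
    using mfun_by_val[of "x \<otimes>\<^bsub>F\<^esub> y" "\<lambda>u. val x u \<otimes>\<^bsub>M\<^esub> val y u"] val_closed x y by auto
qed

lemma mfun_unit:
  assumes q: "q \<in> carrier M"
  shows unit_closed: "unit F q \<in> carrier F"
    and val_unit: "prime_filter B u \<Longrightarrow> val (unit F q) u = q"
proof -
  have "unit F q \<in> carrier M \<rightarrow>\<^sub>E carrier B" by (auto simp: mfun_def)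
  moreover have "unit F q p \<in> u \<longleftrightarrow> p = q" if "prime_filter B u" "p \<in> carrier M" for u p
    using that by (simp add: mfun_def prime_filter_one prime_filter_zero)
  ultimately show "unit F q \<in> carrier F" and "prime_filter B u \<Longrightarrow> val (unit F q) u = q"
    using mfun_by_val[of "unit F q" "\<lambda>_. q"] q by auto
qed

lemma mfun_zero_eq: "\<zero>\<^bsub>F\<^esub> = unit F \<zero>\<^bsub>M\<^esub>" by (simp add: mfun_def)

lemma mfun_one_eq: "\<one>\<^bsub>F\<^esub> = unit F \<one>\<^bsub>M\<^esub>" by (simp add: mfun_def)

lemma mfun_neg:
  assumes x: "x \<in> carrier F"
  shows neg_closed: "\<sim>\<^bsub>F\<^esub> x \<in> carrier F"
    and val_neg: "prime_filter B u \<Longrightarrow> val (\<sim>\<^bsub>F\<^esub> x) u = \<sim>\<^bsub>M\<^esub> (val x u)"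
proof -
  have "\<sim>\<^bsub>F\<^esub> x \<in> carrier M \<rightarrow>\<^sub>E carrier B"
    using component_closed[OF x] M.neg_closed by (auto simp: mfun_def)
  moreover have "(\<sim>\<^bsub>F\<^esub> x) p \<in> u \<longleftrightarrow> p = \<sim>\<^bsub>M\<^esub> (val x u)"
    if u: "prime_filter B u" and p: "p \<in> carrier M" for u p
  proof -
    have "(\<sim>\<^bsub>F\<^esub> x) p \<in> u \<longleftrightarrow> \<sim>\<^bsub>M\<^esub> p = val x u"
      using component_iff_val[OF x u M.neg_closed[OF p]] p by (simp add: mfun_def)
    then show ?thesis using M.neg_neg p val_closed[OF x u] by metis
  qed
  ultimately show "\<sim>\<^bsub>F\<^esub> x \<in> carrier F"
    and "prime_filter B u \<Longrightarrow> val (\<sim>\<^bsub>F\<^esub> x) u = \<sim>\<^bsub>M\<^esub> (val x u)"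
    using mfun_by_val[of "\<sim>\<^bsub>F\<^esub> x" "\<lambda>u. \<sim>\<^bsub>M\<^esub> (val x u)"] val_closed[OF x] M.neg_closed by auto
qed

text \<open>
  In terms of the Stone space, these are the values that \<open>x\<close> takes at the points \<open>s\<close> related to \<open>u\<close>
  by \<open>c\<^sub>\<kappa>\<close>, that is, with \<open>c\<^sub>\<kappa> b \<in> u\<close> for all \<open>b \<in> s\<close>.
\<close>

definition reach :: "'k \<Rightarrow> ('m \<Rightarrow> 'b) \<Rightarrow> 'b set \<Rightarrow> 'm set" where
  "reach \<kappa> x u = {q \<in> carrier M. cyl B \<kappa> (x q) \<in> u}"

text \<open>
  Since \<open>x q \<le> c (x q)\<close>; in particular the supremum taken in \<open>mfun_cyl\<close> is over a nonempty set.
\<close>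

lemma val_in_reach:
  assumes k: "\<kappa> \<in> Field \<alpha>" and x: "x \<in> carrier F" and u: "prime_filter B u"
  shows "val x u \<in> reach \<kappa> x u"
proof -
  let ?b = "x (val x u)"
  have b: "?b \<in> carrier B" "?b \<in> u"
    using val_closed[OF x u] component_closed[OF x] component_iff_val[OF x u] by auto
  then have "cyl B \<kappa> ?b \<in> u"
    using prime_filter_mult[OF u b(1) B.cyl_closed[OF k b(1)]] B.cyl_ge[OF k b(1)]
    by (simp add: lle_def)
  then show ?thesis using val_closed[OF x u] by (simp add: reach_def)
qed

text \<open>
  At a point \<open>u\<close>, the product over \<open>A\<close> in the definition of \<open>c\<close> says \<open>A \<subseteq> reach \<kappa> x u\<close>, and
  \<open>lsup_unique\<close> applies.
\<close>

lemma mfun_cyl: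
  assumes k: "\<kappa> \<in> Field \<alpha>" and x: "x \<in> carrier F"
  shows cyl_closed: "cyl F \<kappa> x \<in> carrier F"
    and val_cyl: "prime_filter B u \<Longrightarrow> val (cyl F \<kappa> x) u = lsup M (reach \<kappa> x u)"
proof -
  let ?P = "\<lambda>S. finprod B (\<lambda>q. cyl B \<kappa> (x q)) S"
  have c: "(\<lambda>q. cyl B \<kappa> (x q)) \<in> S \<rightarrow> carrier B" if "S \<subseteq> carrier M" for S
    using that component_closed[OF x] B.cyl_closed[OF k] by blast
  have P: "?P \<in> sets_sup_eq M p \<rightarrow> carrier B" "?P \<in> sets_sup_gt M p \<rightarrow> carrier B" for p
    using B.finprod_closed[OF c] by (auto simp: sets_sup_eq_def sets_sup_gt_def)
  have Pu: "?P S \<in> u \<longleftrightarrow> S \<subseteq> reach \<kappa> x u"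
    if u: "prime_filter B u" and S: "S \<subseteq> carrier M" for S u
    using B.prime_filter_finprod[OF u finite_subset[OF S M.finite_carrier] c[OF S]] S
    by (auto simp: reach_def)
  have s: "finsum B ?P (sets_sup_eq M p) \<in> carrier B" "finsum B ?P (sets_sup_gt M p) \<in> carrier B"
    for p using P by (auto intro: B.finsum_closed)
  have "cyl F \<kappa> x p \<in> u \<longleftrightarrow> p = lsup M (reach \<kappa> x u)"
    if u: "prime_filter B u" and p: "p \<in> carrier M" for u p
  proof -
    have "finsum B ?P (sets_sup_eq M p) \<in> u \<longleftrightarrow> (\<exists>S \<in> sets_sup_eq M p. S \<subseteq> reach \<kappa> x u)"
      unfolding B.prime_filter_finsum[OF u finite_sets_sup_eq[OF M.finite_carrier] P(1)]
      by (intro bex_cong refl Pu[OF u]) (simp add: sets_sup_eq_def)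
    moreover have "finsum B ?P (sets_sup_gt M p) \<in> u \<longleftrightarrow> (\<exists>S \<in> sets_sup_gt M p. S \<subseteq> reach \<kappa> x u)"
      unfolding B.prime_filter_finsum[OF u finite_sets_sup_gt[OF M.finite_carrier] P(2)]
      by (intro bex_cong refl Pu[OF u]) (simp add: sets_sup_gt_def)
    moreover have "cyl F \<kappa> x p =
        finsum B ?P (sets_sup_eq M p) \<otimes>\<^bsub>B\<^esub> \<sim>\<^bsub>B\<^esub> (finsum B ?P (sets_sup_gt M p))"
      using p by (simp add: mfun_def)
    ultimately have "cyl F \<kappa> x p \<in> u \<longleftrightarrow> (\<exists>S \<in> sets_sup_eq M p. S \<subseteq> reach \<kappa> x u) \<and>
        \<not> (\<exists>S \<in> sets_sup_gt M p. S \<subseteq> reach \<kappa> x u)"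
      using s u by (simp only: prime_filter_mult B.prime_filter_compl B.compl_closed)
    also have "\<dots> \<longleftrightarrow> p = lsup M (reach \<kappa> x u)"
      using val_in_reach[OF k x u] by (intro M.lsup_unique p) (auto simp: reach_def)
    finally show ?thesis .
  qed
  moreover have "cyl F \<kappa> x \<in> carrier M \<rightarrow>\<^sub>E carrier B"
    using s B.compl_closed by (simp add: mfun_def)
  moreover have "lsup M (reach \<kappa> x u) \<in> carrier M" for u
    by (rule M.lsup_closed) (simp add: reach_def)
  ultimately show "cyl F \<kappa> x \<in> carrier F"
    and "prime_filter B u \<Longrightarrow> val (cyl F \<kappa> x) u = lsup M (reach \<kappa> x u)"
    using mfun_by_val[of "cyl F \<kappa> x" "\<lambda>u. lsup M (reach \<kappa> x u)"] by auto
qed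

sublocale F: bounded_distrib_lattice F
proof -
  have c: "\<zero>\<^bsub>F\<^esub> \<in> carrier F" "\<one>\<^bsub>F\<^esub> \<in> carrier F"
    by (simp_all add: mfun_zero_eq mfun_one_eq unit_closed)
  have v: "val \<zero>\<^bsub>F\<^esub> u = \<zero>\<^bsub>M\<^esub>" "val \<one>\<^bsub>F\<^esub> u = \<one>\<^bsub>M\<^esub>" if "prime_filter B u" for u
    using that by (simp_all add: mfun_zero_eq mfun_one_eq val_unit)
  note [simp] = add_closed mult_closed val_add val_mult val_closed c v
  have "abelian_monoid F"
    by (rule abelian_monoidI; (rule eq_by_val)?; simp add: M.a_ac)
  moreover have "comm_monoid F"
    by (rule comm_monoidI; (rule eq_by_val)?; simp add: M.m_ac)
  moreover have "bounded_distrib_lattice_axioms F"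
  proof
    fix x y z assume [simp]: "x \<in> carrier F" "y \<in> carrier F" "z \<in> carrier F"
    show "x \<otimes>\<^bsub>F\<^esub> (y \<oplus>\<^bsub>F\<^esub> z) = x \<otimes>\<^bsub>F\<^esub> y \<oplus>\<^bsub>F\<^esub> x \<otimes>\<^bsub>F\<^esub> z"
      by (rule eq_by_val) (simp_all add: M.mult_add_distrib)
    show "x \<oplus>\<^bsub>F\<^esub> y \<otimes>\<^bsub>F\<^esub> z = (x \<oplus>\<^bsub>F\<^esub> y) \<otimes>\<^bsub>F\<^esub> (x \<oplus>\<^bsub>F\<^esub> z)"
      by (rule eq_by_val) (simp_all add: M.add_mult_distrib)
    show "x \<otimes>\<^bsub>F\<^esub> (x \<oplus>\<^bsub>F\<^esub> y) = x" "x \<oplus>\<^bsub>F\<^esub> x \<otimes>\<^bsub>F\<^esub> y = x"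
      by (rule eq_by_val; simp add: M.mult_absorb M.add_absorb)+
  qed
  ultimately show "bounded_distrib_lattice F" by (rule bounded_distrib_lattice.intro)
qed

section \<open>Cuts\<close>

text \<open>
  For a prime filter \<open>J\<close> of \<open>M\<close>, the part of unity on which the value of \<open>x\<close> lies in \<open>J\<close>.
\<close>

definition cut :: "'m set \<Rightarrow> ('m \<Rightarrow> 'b) \<Rightarrow> 'b" where
  "cut J x = finsum B x J"

context
  fixes J assumes J: "prime_filter M J"
begin

lemma cut_closed: assumes x: "x \<in> carrier F" shows "cut J x \<in> carrier B"
  unfolding cut_def using component_closed[OF x] prime_filter_subset[OF J]
  by (intro B.finsum_closed) auto

lemma cut_iff_val:
  assumes x: "x \<in> carrier F" and u: "prime_filter B u"
  shows "cut J x \<in> u \<longleftrightarrow> val x u \<in> J"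
proof -
  have "cut J x \<in> u \<longleftrightarrow> (\<exists>q \<in> J. x q \<in> u)"
    unfolding cut_def using prime_filter_subset[OF J] component_closed[OF x]
    by (intro B.prime_filter_finsum[OF u] finite_subset[OF _ M.finite_carrier]) auto
  then show ?thesis using component_iff_val[OF x u] prime_filter_subset[OF J] by blast
qed

lemma cut_add:
  assumes "x \<in> carrier F" and "y \<in> carrier F"
  shows "cut J (x \<oplus>\<^bsub>F\<^esub> y) = cut J x \<oplus>\<^bsub>B\<^esub> cut J y"
  by (rule B.eq_by_prime_filters)
    (use assms J in \<open>simp_all add: cut_iff_val val_add val_closed prime_filter_add
      add_closed cut_closed\<close>)

lemma cut_mult:
  assumes "x \<in> carrier F" and "y \<in> carrier F"
  shows "cut J (x \<otimes>\<^bsub>F\<^esub> y) = cut J x \<otimes>\<^bsub>B\<^esub> cut J y"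
  by (rule B.eq_by_prime_filters)
    (use assms J in \<open>simp_all add: cut_iff_val val_mult val_closed prime_filter_mult
      mult_closed cut_closed\<close>)

text \<open>
  As \<open>J\<close> is prime, the supremum of \<open>reach \<kappa> x u\<close> lies in \<open>J\<close> iff \<open>c (x q) \<in> u\<close> for some
  \<open>q \<in> J\<close>, that is, iff the sum of all \<open>c (x q)\<close> with \<open>q \<in> J\<close> is in \<open>u\<close>. By additivity
  of \<open>c\<close> that sum is \<open>c\<close> of the cut.
\<close>

lemma cut_cyl:
  assumes k: "\<kappa> \<in> Field \<alpha>" and x: "x \<in> carrier F"
  shows "cut J (cyl F \<kappa> x) = cyl B \<kappa> (cut J x)"
proof (rule B.eq_by_prime_filters)
  have JM: "J \<subseteq> carrier M" using J by (rule prime_filter_subset)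
  have fin: "finite J" using JM M.finite_carrier by (rule finite_subset)
  have x_J: "x \<in> J \<rightarrow> carrier B" using component_closed[OF x] JM by blast
  then have c_J: "(\<lambda>q. cyl B \<kappa> (x q)) \<in> J \<rightarrow> carrier B" using B.cyl_closed[OF k] by blast
  fix u assume u: "prime_filter B u"
  have "cut J (cyl F \<kappa> x) \<in> u \<longleftrightarrow> lsup M (reach \<kappa> x u) \<in> J"
    using cut_iff_val[OF cyl_closed[OF k x] u] val_cyl[OF k x u] by simp
  also have "\<dots> \<longleftrightarrow> (\<exists>q \<in> reach \<kappa> x u. q \<in> J)"
    by (rule M.lsup_prime_filter[OF J]) (simp add: reach_def)
  also have "\<dots> \<longleftrightarrow> (\<exists>q \<in> J. cyl B \<kappa> (x q) \<in> u)" using JM by (auto simp: reach_def)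
  also have "\<dots> \<longleftrightarrow> finsum B (\<lambda>q. cyl B \<kappa> (x q)) J \<in> u"
    using B.prime_filter_finsum[OF u fin c_J] by simp
  also have "finsum B (\<lambda>q. cyl B \<kappa> (x q)) J = cyl B \<kappa> (cut J x)"
    unfolding cut_def by (rule B.cyl_finsum[OF k fin x_J, symmetric])
  finally show "cut J (cyl F \<kappa> x) \<in> u \<longleftrightarrow> cyl B \<kappa> (cut J x) \<in> u" .
qed (use k x in \<open>simp_all add: cut_closed cyl_closed B.cyl_closed\<close>)

end

text \<open>
  The cuts determine which prime filters of \<open>M\<close> contain the value of \<open>x\<close> at each point, and
  the prime filters of \<open>M\<close> separate its elements.
\<close>

lemma eq_by_cuts:
  assumes x: "x \<in> carrier F" and y: "y \<in> carrier F"
    and *: "\<And>J. prime_filter M J \<Longrightarrow> cut J x = cut J y"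
  shows "x = y"
proof (rule eq_by_val[OF x y])
  fix u assume u: "prime_filter B u"
  show "val x u = val y u"
  proof (rule M.eq_by_prime_filters)
    fix J assume J: "prime_filter M J"
    show "val x u \<in> J \<longleftrightarrow> val y u \<in> J"
      using cut_iff_val[OF J x u] cut_iff_val[OF J y u] *[OF J] by simp
  qed (use x y u val_closed in auto)
qed

section \<open>Two-valued elements\<close>

definition two :: "'b \<Rightarrow> 'm \<Rightarrow> 'b" where
  "two b = (\<lambda>p \<in> carrier M. if p = \<one>\<^bsub>M\<^esub> then b else if p = \<zero>\<^bsub>M\<^esub> then \<sim>\<^bsub>B\<^esub> b else \<zero>\<^bsub>B\<^esub>)"

lemma two_one: "two b \<one>\<^bsub>M\<^esub> = b"
  by (simp add: two_def)

lemma two_zero: "two b \<zero>\<^bsub>M\<^esub> = \<sim>\<^bsub>B\<^esub> b"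
  using M.zero_neq_one by (simp add: two_def)

lemma two_other: "\<lbrakk>p \<in> carrier M; p \<noteq> \<zero>\<^bsub>M\<^esub>; p \<noteq> \<one>\<^bsub>M\<^esub>\<rbrakk> \<Longrightarrow> two b p = \<zero>\<^bsub>B\<^esub>"
  by (simp add: two_def)

lemma two_carrier:
  assumes b: "b \<in> carrier B"
  shows two_closed: "two b \<in> carrier F"
    and val_two: "prime_filter B u \<Longrightarrow> val (two b) u = (if b \<in> u then \<one>\<^bsub>M\<^esub> else \<zero>\<^bsub>M\<^esub>)"
proof -
  have "two b \<in> carrier M \<rightarrow>\<^sub>E carrier B" using b B.compl_closed by (auto simp: two_def)
  moreover have "two b p \<in> u \<longleftrightarrow> p = (if b \<in> u then \<one>\<^bsub>M\<^esub> else \<zero>\<^bsub>M\<^esub>)"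
    if "prime_filter B u" "p \<in> carrier M" for u p
    using that b M.zero_neq_one by (auto simp: two_def prime_filter_zero B.prime_filter_compl)
  ultimately show "two b \<in> carrier F"
    and "prime_filter B u \<Longrightarrow> val (two b) u = (if b \<in> u then \<one>\<^bsub>M\<^esub> else \<zero>\<^bsub>M\<^esub>)"
    using mfun_by_val[of "two b" "\<lambda>u. if b \<in> u then \<one>\<^bsub>M\<^esub> else \<zero>\<^bsub>M\<^esub>"] by auto
qed

text \<open>
  Every prime filter of \<open>M\<close> contains 1 and omits 0, so it sees \<open>two b\<close> exactly on \<open>b\<close>. Together
  with \<open>eq_by_cuts\<close> this makes \<open>two\<close> a homomorphism for every operation that the cuts preserve.
\<close>

lemma cut_two:
  assumes J: "prime_filter M J" and b: "b \<in> carrier B"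
  shows "cut J (two b) = b"
  by (rule B.eq_by_prime_filters)
    (use J b in \<open>simp_all add: cut_closed two_closed cut_iff_val val_two
      prime_filter_one prime_filter_zero\<close>)

lemma two_zero_eq: "two \<zero>\<^bsub>B\<^esub> = unit F \<zero>\<^bsub>M\<^esub>"
  by (rule eq_by_val) (simp_all add: two_closed unit_closed val_two val_unit prime_filter_zero)

lemma two_one_eq: "two \<one>\<^bsub>B\<^esub> = unit F \<one>\<^bsub>M\<^esub>"
  by (rule eq_by_val) (simp_all add: two_closed unit_closed val_two val_unit prime_filter_one)

lemma two_add:
  "\<lbrakk>a \<in> carrier B; b \<in> carrier B\<rbrakk> \<Longrightarrow> two (a \<oplus>\<^bsub>B\<^esub> b) = two a \<oplus>\<^bsub>F\<^esub> two b"
  by (rule eq_by_cuts) (simp_all add: two_closed add_closed cut_two cut_add)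

lemma two_mult:
  "\<lbrakk>a \<in> carrier B; b \<in> carrier B\<rbrakk> \<Longrightarrow> two (a \<otimes>\<^bsub>B\<^esub> b) = two a \<otimes>\<^bsub>F\<^esub> two b"
  by (rule eq_by_cuts) (simp_all add: two_closed mult_closed cut_two cut_mult)

lemma two_cyl:
  "\<lbrakk>\<kappa> \<in> Field \<alpha>; b \<in> carrier B\<rbrakk> \<Longrightarrow> two (cyl B \<kappa> b) = cyl F \<kappa> (two b)"
  by (rule eq_by_cuts) (simp_all add: two_closed cyl_closed B.cyl_closed cut_two cut_cyl)

lemma two_compl: "b \<in> carrier B \<Longrightarrow> two (\<sim>\<^bsub>B\<^esub> b) = \<sim>\<^bsub>F\<^esub> (two b)"
  by (rule eq_by_val)
    (simp_all add: two_closed neg_closed B.compl_closed val_two val_neg B.prime_filter_compl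
      M.neg_zero M.neg_one)

lemma two_finsum:
  assumes "finite S" and "f \<in> S \<rightarrow> carrier B"
  shows "two (finsum B f S) = finsum F (\<lambda>s. two (f s)) S"
  using assms
proof (induction S)
  case empty
  then show ?case by (simp add: two_zero_eq mfun_zero_eq)
next
  case (insert s S)
  then have "f s \<in> carrier B" "f \<in> S \<rightarrow> carrier B" "(\<lambda>s. two (f s)) \<in> S \<rightarrow> carrier F"
    using two_closed by auto
  then show ?case using insert by (simp add: two_add two_closed)
qed

lemma two_finprod:
  assumes "finite S" and "f \<in> S \<rightarrow> carrier B"
  shows "two (finprod B f S) = finprod F (\<lambda>s. two (f s)) S"
  using assms
proof (induction S)
  case empty
  then show ?case by (simp add: two_one_eq mfun_one_eq)
next
  case (insert s S)
  then have "f s \<in> carrier B" "f \<in> S \<rightarrow> carrier B" "(\<lambda>s. two (f s)) \<in> S \<rightarrow> carrier F"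
    using two_closed by auto
  then show ?case using insert by (simp add: two_mult two_closed)
qed

lemma delta_eq: "delta F p x = two (x p)"
  by (simp add: mfun_def two_def)

lemma diag_eq: "diag F \<kappa> \<nu> = two (diag B \<kappa> \<nu>)"
  by (simp add: mfun_def two_def)

text \<open>
  The axiom that expresses \<open>\<delta>\<^sub>p c\<^sub>\<kappa> a\<close> through the elements \<open>c\<^sub>\<kappa> \<delta>\<^sub>q a\<close> has the same form as the
  definition of the component \<open>(c\<^sub>\<kappa> a) p\<close>; applying \<open>two\<close> to that definition yields it.
\<close>

lemma two_cyl_component:
  assumes k: "\<kappa> \<in> Field \<alpha>" and x: "x \<in> carrier F" and p: "p \<in> carrier M"
  shows "two (cyl F \<kappa> x p) =
    finsum F (\<lambda>S. finprod F (\<lambda>q. cyl F \<kappa> (two (x q))) S) (sets_sup_eq M p) \<otimes>\<^bsub>F\<^esub>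
    \<sim>\<^bsub>F\<^esub> (finsum F (\<lambda>S. finprod F (\<lambda>q. cyl F \<kappa> (two (x q))) S) (sets_sup_gt M p))"
proof -
  let ?P = "\<lambda>S. finprod B (\<lambda>q. cyl B \<kappa> (x q)) S"
  let ?Q = "\<lambda>S. finprod F (\<lambda>q. cyl F \<kappa> (two (x q))) S"
  have c: "(\<lambda>q. cyl B \<kappa> (x q)) \<in> S \<rightarrow> carrier B" if "S \<subseteq> carrier M" for S
    using that component_closed[OF x] B.cyl_closed[OF k] by blast
  have Q: "two (?P S) = ?Q S" if S: "S \<subseteq> carrier M" for S
  proof -
    have "two (?P S) = finprod F (\<lambda>q. two (cyl B \<kappa> (x q))) S"
      using S by (intro two_finprod c finite_subset[OF S M.finite_carrier])
    also have "\<dots> = ?Q S"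
      using S k x by (intro F.finprod_cong')
        (auto simp: two_cyl component_closed cyl_closed two_closed subset_iff)
    finally show ?thesis .
  qed
  have P: "?P S \<in> carrier B" if "S \<subseteq> carrier M" for S using B.finprod_closed[OF c[OF that]] .
  have sum: "two (finsum B ?P \<S>) = finsum F ?Q \<S>" "finsum B ?P \<S> \<in> carrier B"
    if \<S>: "\<S> \<subseteq> Pow (carrier M)" for \<S>
  proof -
    have PS: "?P \<in> \<S> \<rightarrow> carrier B" using P \<S> by blast
    then show "finsum B ?P \<S> \<in> carrier B" by (rule B.finsum_closed)
    have "two (finsum B ?P \<S>) = finsum F (\<lambda>S. two (?P S)) \<S>"
      by (rule two_finsum[OF finite_subset[OF \<S>] PS]) (simp add: M.finite_carrier)
    also have "\<dots> = finsum F ?Q \<S>"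
      using \<S> by (intro F.finsum_cong') (auto simp: Q[symmetric] subset_iff P two_closed)
    finally show "two (finsum B ?P \<S>) = finsum F ?Q \<S>" .
  qed
  have sub: "sets_sup_eq M p \<subseteq> Pow (carrier M)" "sets_sup_gt M p \<subseteq> Pow (carrier M)"
    by (auto simp: sets_sup_eq_def sets_sup_gt_def)
  have "cyl F \<kappa> x p = finsum B ?P (sets_sup_eq M p) \<otimes>\<^bsub>B\<^esub> \<sim>\<^bsub>B\<^esub> (finsum B ?P (sets_sup_gt M p))"
    using p by (simp add: mfun_def)
  then show ?thesis
    using sum(2)[OF sub(1)] sum(2)[OF sub(2)] B.compl_closed
    by (simp add: two_mult two_compl sum(1)[OF sub(1)] sum(1)[OF sub(2)])
qed

lemma two_pair_sum:
  assumes x: "x \<in> carrier F" and y: "y \<in> carrier F" and T: "T \<subseteq> carrier M \<times> carrier M"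
  shows "two (finsum B (\<lambda>(q, r). x q \<otimes>\<^bsub>B\<^esub> y r) T) =
    finsum F (\<lambda>(q, r). two (x q) \<otimes>\<^bsub>F\<^esub> two (y r)) T"
proof -
  let ?f = "\<lambda>(q, r). x q \<otimes>\<^bsub>B\<^esub> y r"
  have "finite T" using T M.finite_carrier by (blast intro: finite_subset)
  moreover have "?f \<in> T \<rightarrow> carrier B" using x y T by (auto simp: component_closed)
  ultimately have "two (finsum B ?f T) = finsum F (\<lambda>s. two (?f s)) T" by (rule two_finsum)
  also have "\<dots> = finsum F (\<lambda>(q, r). two (x q) \<otimes>\<^bsub>F\<^esub> two (y r)) T"
    using x y T by (intro F.finsum_cong') (auto simp: two_mult component_closed two_closed)
  finally show ?thesis .
qed

theorem mfun_m_cylindric: "m_cylindric_algebra F M \<alpha>"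
proof (intro m_cylindric_algebra.intro m_cylindric_algebra_axioms.intro)
  show "abelian_monoid F" "comm_monoid F" "finite_de_morgan_algebra M" by unfold_locales
next
  note [simp] = delta_eq diag_eq component_closed two_closed unit_closed neg_closed cyl_closed
    B.compl_closed B.cyl_closed B.diag_closed M.neg_closed
  (* These rules collect an expression in two-valued elements into one application of two. *)
  note hom = two_add[symmetric] two_mult[symmetric] two_compl[symmetric] two_cyl[symmetric]
    two_zero_eq[symmetric] two_one_eq[symmetric]
  show "\<zero>\<^bsub>F\<^esub> = unit F \<zero>\<^bsub>M\<^esub>" "\<one>\<^bsub>F\<^esub> = unit F \<one>\<^bsub>M\<^esub>" by (fact mfun_zero_eq mfun_one_eq)+
  fix p q a b c \<kappa> \<nu> \<mu>
  show "\<lbrakk>a \<in> carrier F; b \<in> carrier F; c \<in> carrier F\<rbrakk>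
      \<Longrightarrow> a \<otimes>\<^bsub>F\<^esub> (b \<oplus>\<^bsub>F\<^esub> c) = a \<otimes>\<^bsub>F\<^esub> b \<oplus>\<^bsub>F\<^esub> a \<otimes>\<^bsub>F\<^esub> c"
    "\<lbrakk>a \<in> carrier F; b \<in> carrier F; c \<in> carrier F\<rbrakk>
      \<Longrightarrow> a \<oplus>\<^bsub>F\<^esub> b \<otimes>\<^bsub>F\<^esub> c = (a \<oplus>\<^bsub>F\<^esub> b) \<otimes>\<^bsub>F\<^esub> (a \<oplus>\<^bsub>F\<^esub> c)"
    by (fact F.mult_add_distrib F.add_mult_distrib)+
  show "a \<in> carrier F \<Longrightarrow> \<sim>\<^bsub>F\<^esub> a \<in> carrier F"
    "p \<in> carrier M \<Longrightarrow> unit F p \<in> carrier F"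
    "\<lbrakk>\<kappa> \<in> Field \<alpha>; a \<in> carrier F\<rbrakk> \<Longrightarrow> cyl F \<kappa> a \<in> carrier F"
    "\<lbrakk>\<kappa> \<in> Field \<alpha>; \<nu> \<in> Field \<alpha>\<rbrakk> \<Longrightarrow> diag F \<kappa> \<nu> \<in> carrier F"
    "\<lbrakk>p \<in> carrier M; a \<in> carrier F\<rbrakk> \<Longrightarrow> delta F p a \<in> carrier F"
    by simp_all
  show "\<lbrakk>p \<in> carrier M; a \<in> carrier F\<rbrakk>
      \<Longrightarrow> delta F p a \<oplus>\<^bsub>F\<^esub> \<sim>\<^bsub>F\<^esub> (delta F p a) = unit F \<one>\<^bsub>M\<^esub>"
    "\<lbrakk>p \<in> carrier M; a \<in> carrier F\<rbrakk>
      \<Longrightarrow> delta F p a \<otimes>\<^bsub>F\<^esub> \<sim>\<^bsub>F\<^esub> (delta F p a) = unit F \<zero>\<^bsub>M\<^esub>"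
    by (simp_all add: hom B.add_compl B.mult_compl)
  show "\<kappa> \<in> Field \<alpha> \<Longrightarrow> cyl F \<kappa> (unit F \<zero>\<^bsub>M\<^esub>) = unit F \<zero>\<^bsub>M\<^esub>"
    by (simp add: hom B.cyl_zero)
  (* The next three axioms hold because they hold for all cuts. *)
  show "a \<oplus>\<^bsub>F\<^esub> cyl F \<kappa> a = cyl F \<kappa> a" if k: "\<kappa> \<in> Field \<alpha>" and a: "a \<in> carrier F"
  proof (rule eq_by_cuts)
    fix J assume J: "prime_filter M J"
    let ?b = "cut J a"
    have b: "?b \<in> carrier B" using cut_closed[OF J a] .
    have "?b \<oplus>\<^bsub>B\<^esub> cyl B \<kappa> ?b = cyl B \<kappa> ?b"
      using B.cyl_ge[OF k b] B.add_absorb[of "cyl B \<kappa> ?b" ?b] b k B.m_comm B.a_comm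
      by (simp add: lle_def)
    then show "cut J (a \<oplus>\<^bsub>F\<^esub> cyl F \<kappa> a) = cut J (cyl F \<kappa> a)"
      using J a k by (simp add: cut_add cut_cyl)
  qed (use k a in auto)
  show "cyl F \<kappa> (a \<otimes>\<^bsub>F\<^esub> cyl F \<kappa> b) = cyl F \<kappa> a \<otimes>\<^bsub>F\<^esub> cyl F \<kappa> b"
    if "\<kappa> \<in> Field \<alpha>" "a \<in> carrier F" "b \<in> carrier F"
    by (rule eq_by_cuts) (use that in \<open>simp_all add: cut_cyl cut_mult cut_closed B.cyl_mult_cyl\<close>)
  show "cyl F \<kappa> (cyl F \<nu> a) = cyl F \<nu> (cyl F \<kappa> a)"
    if "\<kappa> \<in> Field \<alpha>" "\<nu> \<in> Field \<alpha>" "a \<in> carrier F"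
    by (rule eq_by_cuts) (use that B.cyl_commute in \<open>simp_all add: cut_cyl cut_closed\<close>)
  show "diag F \<nu> \<mu> = cyl F \<kappa> (diag F \<nu> \<kappa> \<otimes>\<^bsub>F\<^esub> diag F \<kappa> \<mu>)"
    if "\<kappa> \<in> Field \<alpha>" "\<nu> \<in> Field \<alpha>" "\<mu> \<in> Field \<alpha>" "\<kappa> \<notin> {\<nu>, \<mu>}"
    using that B.diag_trans[OF that] by (simp add: hom)
  show "\<kappa> \<in> Field \<alpha> \<Longrightarrow> diag F \<kappa> \<kappa> = unit F \<one>\<^bsub>M\<^esub>"
    by (simp add: hom B.diag_refl)
  show "\<lbrakk>\<kappa> \<in> Field \<alpha>; \<nu> \<in> Field \<alpha>; \<kappa> \<noteq> \<nu>; a \<in> carrier F\<rbrakk>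
      \<Longrightarrow> cyl F \<kappa> (diag F \<kappa> \<nu> \<otimes>\<^bsub>F\<^esub> delta F \<one>\<^bsub>M\<^esub> a) \<otimes>\<^bsub>F\<^esub>
          cyl F \<kappa> (diag F \<kappa> \<nu> \<otimes>\<^bsub>F\<^esub> \<sim>\<^bsub>F\<^esub> (delta F \<one>\<^bsub>M\<^esub> a)) = unit F \<zero>\<^bsub>M\<^esub>"
    by (simp add: hom B.cyl_diag)
  show "\<lbrakk>a \<in> carrier F; b \<in> carrier F\<rbrakk> \<Longrightarrow>
      delta F \<one>\<^bsub>M\<^esub> (delta F \<one>\<^bsub>M\<^esub> a \<oplus>\<^bsub>F\<^esub> delta F \<one>\<^bsub>M\<^esub> b) = delta F \<one>\<^bsub>M\<^esub> a \<oplus>\<^bsub>F\<^esub> delta F \<one>\<^bsub>M\<^esub> b"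
    "\<lbrakk>a \<in> carrier F; b \<in> carrier F\<rbrakk> \<Longrightarrow>
      delta F \<one>\<^bsub>M\<^esub> (delta F \<one>\<^bsub>M\<^esub> a \<otimes>\<^bsub>F\<^esub> delta F \<one>\<^bsub>M\<^esub> b) = delta F \<one>\<^bsub>M\<^esub> a \<otimes>\<^bsub>F\<^esub> delta F \<one>\<^bsub>M\<^esub> b"
    "a \<in> carrier F \<Longrightarrow> delta F \<one>\<^bsub>M\<^esub> (\<sim>\<^bsub>F\<^esub> (delta F \<one>\<^bsub>M\<^esub> a)) = \<sim>\<^bsub>F\<^esub> (delta F \<one>\<^bsub>M\<^esub> a)"
    "\<lbrakk>\<kappa> \<in> Field \<alpha>; a \<in> carrier F\<rbrakk> \<Longrightarrow>
      delta F \<one>\<^bsub>M\<^esub> (cyl F \<kappa> (delta F \<one>\<^bsub>M\<^esub> a)) = cyl F \<kappa> (delta F \<one>\<^bsub>M\<^esub> a)"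
    "\<lbrakk>\<kappa> \<in> Field \<alpha>; \<nu> \<in> Field \<alpha>\<rbrakk> \<Longrightarrow> delta F \<one>\<^bsub>M\<^esub> (diag F \<kappa> \<nu>) = diag F \<kappa> \<nu>"
    "\<lbrakk>q \<in> carrier M; a \<in> carrier F\<rbrakk> \<Longrightarrow> delta F \<one>\<^bsub>M\<^esub> (delta F q a) = delta F q a"
    by (simp_all add: hom two_one)
  show "\<lbrakk>\<kappa> \<in> Field \<alpha>; \<nu> \<in> Field \<alpha>\<rbrakk> \<Longrightarrow> delta F \<zero>\<^bsub>M\<^esub> (diag F \<kappa> \<nu>) = \<sim>\<^bsub>F\<^esub> (diag F \<kappa> \<nu>)"
    "\<lbrakk>q \<in> carrier M; a \<in> carrier F\<rbrakk> \<Longrightarrow> delta F \<zero>\<^bsub>M\<^esub> (delta F q a) = \<sim>\<^bsub>F\<^esub> (delta F q a)"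
    by (simp_all add: two_compl two_zero)
  show "\<lbrakk>\<kappa> \<in> Field \<alpha>; \<nu> \<in> Field \<alpha>; p \<in> carrier M; p \<noteq> \<zero>\<^bsub>M\<^esub>; p \<noteq> \<one>\<^bsub>M\<^esub>\<rbrakk>
      \<Longrightarrow> delta F p (diag F \<kappa> \<nu>) = unit F \<zero>\<^bsub>M\<^esub>"
    "\<lbrakk>p \<in> carrier M; q \<in> carrier M; p \<noteq> \<zero>\<^bsub>M\<^esub>; p \<noteq> \<one>\<^bsub>M\<^esub>; a \<in> carrier F\<rbrakk>
      \<Longrightarrow> delta F p (delta F q a) = unit F \<zero>\<^bsub>M\<^esub>"
    by (simp_all add: two_other two_zero_eq)
  show "\<lbrakk>p \<in> carrier M; a \<in> carrier F\<rbrakk> \<Longrightarrow> delta F p (\<sim>\<^bsub>F\<^esub> a) = delta F (\<sim>\<^bsub>M\<^esub> p) a"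
    by (simp, simp add: mfun_def)
  show "p \<in> carrier M \<Longrightarrow> delta F p (unit F p) = unit F \<one>\<^bsub>M\<^esub>"
    by (simp add: hom, simp add: mfun_def)
  show "\<lbrakk>p \<in> carrier M; q \<in> carrier M; p \<noteq> q\<rbrakk> \<Longrightarrow> delta F p (unit F q) = unit F \<zero>\<^bsub>M\<^esub>"
    by (simp add: hom, simp add: mfun_def)
  show "\<lbrakk>p \<in> carrier M; q \<in> carrier M; p \<noteq> q; a \<in> carrier F\<rbrakk>
      \<Longrightarrow> delta F p a \<otimes>\<^bsub>F\<^esub> delta F q a = unit F \<zero>\<^bsub>M\<^esub>"
    by (simp add: hom, simp add: mfun_def)
  show "finsum F (\<lambda>p. delta F p a) (carrier M) = unit F \<one>\<^bsub>M\<^esub>" if a: "a \<in> carrier F"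
  proof -
    have "finsum B a (carrier M) = \<one>\<^bsub>B\<^esub>" using a by (simp add: mfun_def)
    then show ?thesis
      using two_finsum[OF M.finite_carrier, of a] component_closed[OF a] by (simp add: two_one_eq)
  qed
  show "\<lbrakk>p \<in> carrier M; a \<in> carrier F; b \<in> carrier F\<rbrakk> \<Longrightarrow> delta F p (a \<oplus>\<^bsub>F\<^esub> b) =
      finsum F (\<lambda>(q, r). delta F q a \<otimes>\<^bsub>F\<^esub> delta F r b) (add_pairs M p)"
    by (simp add: add_component two_pair_sum add_pairs_subset)
  show "\<lbrakk>p \<in> carrier M; a \<in> carrier F; b \<in> carrier F\<rbrakk> \<Longrightarrow> delta F p (a \<otimes>\<^bsub>F\<^esub> b) =
      finsum F (\<lambda>(q, r). delta F q a \<otimes>\<^bsub>F\<^esub> delta F r b) (mult_pairs M p)"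
    by (simp add: mult_component two_pair_sum mult_pairs_subset)
  show "a = b" if "a \<in> carrier F" "b \<in> carrier F"
    "\<And>p. p \<in> carrier M \<Longrightarrow> delta F p a = delta F p b"
  proof (rule PiE_ext[OF mfun_funcset[OF that(1)] mfun_funcset[OF that(2)]])
    fix p assume "p \<in> carrier M"
    then have "two (a p) = two (b p)" using that by simp
    then show "a p = b p" using two_one by metis
  qed
  show "\<lbrakk>p \<in> carrier M; \<kappa> \<in> Field \<alpha>; a \<in> carrier F\<rbrakk> \<Longrightarrow> delta F p (cyl F \<kappa> a) =
      finsum F (\<lambda>S. finprod F (\<lambda>q. cyl F \<kappa> (delta F q a)) S) (sets_sup_eq M p) \<otimes>\<^bsub>F\<^esub>
      \<sim>\<^bsub>F\<^esub> (finsum F (\<lambda>S. finprod F (\<lambda>q. cyl F \<kappa> (delta F q a)) S) (sets_sup_gt M p))"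
    by (simp add: two_cyl_component)
qed

end

theorem theorem2p13:
  fixes M :: "('m, 'y) lattice_alg_scheme"
    and \<alpha> :: "'k rel"
    and B :: "('b, 'k, 'z) cyl_alg_scheme"
  assumes "finite_de_morgan_algebra M"
    and "Well_order \<alpha>"
    and "cylindric_algebra B \<alpha>"
  shows "m_cylindric_algebra (mfun M B) M \<alpha>"
  using assms by (intro mfun_algebra.mfun_m_cylindric mfun_algebra.intro)

end
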